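(* Let $n\ge 2$, $1\le d\le n-1$, and let $w$ be a weight such that $c_w^2\le W_k\le C_w^2$ for all $k\in\mathbb{Z}^n$, for some uniform constants $c_w,C_w>0$. Suppose $r,t,s,\delta\in\mathbb{R}$ are constants such that $2s+t\ge r$, $\delta\ge0$, and $s>0$. Let $g\in L_t^{2,2}(X_{d,n};w)$ and $f\in H^{r+\delta}(\mathbb{T}^n)$. Then the Tikhonov regularized reconstruction operator $P_{w,s}^\alpha R_d^*$ is a regularization strategy in the sense that $$\lim_{\epsilon\to0}\ \sup_{\|g\|_{L_t^{2,2}(X_{d,n};w)}\le\epsilon}\|P_{w,s}^{\alpha(\epsilon)}R_d^*(R_df+g)-f\|_{H^r(\mathbb{T}^n)}=0,$$ where $\alpha(\epsilon)=\sqrt{\epsilon}$ is an admissible choice of the regularization parameter. Moreover, if $\|g\|_{L_t^{2,2}(X_{d,n};w)}\le\epsilon$, $0<\delta<2s$, and $0<\alpha\le c_w^2(2s/\delta-1)$, we have the quantitative convergence rate $$\|P_{w,s}^\alpha R_d^*(R_df+g)-f\|_{H^r(\mathbb{T}^n)}\le\alpha^{\delta/(2s)}c_w^{-\delta/s}\,C(\delta/(2s))\,\|f\|_{H^{r+\delta}(\mathbb{T}^n)}+C_w^3c_w^{-2}\frac{\epsilon}{\alpha},$$ where $C(x)=x(x^{-1}-1)^{1-x}$.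
   Context: Let $\mathbb{T}^n=\mathbb{R}^n/\mathbb{Z}^n$, $\mathcal{T}=C^\infty(\mathbb{T}^n)$, and let $\mathcal{T}'$ be its dual, the space of periodic distributions, with duality pairing $(\cdot,\cdot)$ (so $(f,g)=\int_{\mathbb{T}^n}fg$ for functions). Fourier coefficients are $\hat f(k)=(f,e^{-2\pi i k\cdot x})$, $k\in\mathbb{Z}^n$. $\mathbf{Gr}(d,n)$ is the set of all $d$-dimensional linear subspaces of $\mathbb{Q}^n$; $k\perp A$ means $k\cdot v=0$ for all $v\in A$. Radon transform: for $f\in\mathcal{T}$ and linearly independent $v_1,\dots,v_d\in\mathbb{Z}^n$, with $A=\{v_1,\dots,v_d\}$, $R_df(x,A)=\int_{[0,1]^d}f(x+t_1v_1+\cdots+t_dv_d)\,dt_1\cdots dt_d$. For $f\in\mathcal{T}'$, $R_df(\cdot,A)\in\mathcal{T}'$ is defined by $(R_df(\cdot,A),g)=(f,R_dg(\cdot,A))$ for all $g\in\mathcal{T}$. This depends only on the subspace of $\mathbb{Q}^n$ spanned by $A$, so $R_df(\cdot,A)$ is regarded as defined for $A\in\mathbf{Gr}(d,n)$. For $\omega:\mathbb{Z}^n\to\mathbb{R}$, $F_\omega$ is the Fourier multiplier $\widehat{F_\omega f}(k)=\omega(k)\hat f(k)$. Write $\langle k\rangle=(1+|k|^2)^{1/2}$. For $s\in\mathbb{R}$, $H^s(\mathbb{T}^n)$ is the set of $f\in\mathcal{T}'$ with $\|f\|_{H^s}^2=\sum_k\langle k\rangle^{2s}|\hat f(k)|^2<\infty$.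 Weights: a weight is a function $w:\mathbb{Z}^n\times\mathbf{Gr}(d,n)\to(0,\infty)$ such that for each fixed $A$ there exist $C,N>0$ (possibly depending on $A$) with $w(k,A)\ge C\langle k\rangle^{-N}$ for all $k\in\mathbb{Z}^n$. Set $\Omega_k=\{A\in\mathbf{Gr}(d,n):k\perp A\}$ and $W_k=\sum_{A\in\Omega_k}w(k,A)^2$. Data space: $X_{d,n}=\mathbb{T}^n\times\mathbf{Gr}(d,n)$, and for $t\in\mathbb{R}$, $L_t^{2,2}(X_{d,n};w)$ is the Hilbert space of families $g=\{g(\cdot,A)\}_{A\in\mathbf{Gr}(d,n)}$ with $g(\cdot,A)\in\mathcal{T}'$ and $\|g\|^2=\sum_{A}\|F_{w(\cdot,A)}g(\cdot,A)\|_{H^t(\mathbb{T}^n)}^2<\infty$, with the corresponding inner product. $R_d^*$ is the adjoint of $R_d:H^t(\mathbb{T}^n)\to L_t^{2,2}(X_{d,n};w)$ for any $t$, given (independently of $t$) by $\widehat{R_d^*g}(k)=\sum_{A\in\Omega_k}w(k,A)^2\hat g(k,A)$, where $\hat g(k,A)$ is the $k$-th Fourier coefficient of $g(\cdot,A)$. For $z\in\mathbb{R}$ and $\alpha>0$, $P_{w,z}^\alpha:\mathcal{T}'\to\mathcal{T}'$ is the Fourier multiplier with symbol $p_{w,z}^\alpha(k)=\dfrac{1}{W_k+\alpha\langle k\rangle^{2z}}$. *)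

theory Defs
  imports "HOL-Analysis.Analysis" "HOL-Library.Function_Algebras"
begin

text \<open>Functions on the torus are \<open>\<int>\<^sup>n\<close>-periodic functions on \<open>\<real>\<^sup>n\<close>; the dimension \<open>n\<close> is
  \<open>CARD('n)\<close>.\<close>

definition vec_of_int :: "int^'n \<Rightarrow> real^'n" where
  "vec_of_int k = (\<chi> i. of_int (k $ i))"

definition periodic :: "(real^'n \<Rightarrow> complex) \<Rightarrow> bool" where
  "periodic \<phi> \<longleftrightarrow> (\<forall>k x. \<phi> (x + vec_of_int k) = \<phi> x)"

definition partial :: "'n \<Rightarrow> (real^'n \<Rightarrow> complex) \<Rightarrow> real^'n \<Rightarrow> complex" where
  "partial i \<phi> x = frechet_derivative \<phi> (at x) (axis i 1)"

definition partials :: "'n list \<Rightarrow> (real^'n \<Rightarrow> complex) \<Rightarrow> real^'n \<Rightarrow> complex" where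
  "partials is \<phi> = foldr partial is \<phi>"

text \<open>Total differentiability of all iterated partial derivatives (which includes their
  continuity) amounts to \<open>C\<^sup>\<infinity>\<close>.\<close>

definition smooth :: "(real^'n \<Rightarrow> complex) \<Rightarrow> bool" where
  "smooth \<phi> \<longleftrightarrow> (\<forall>is x. partials is \<phi> differentiable (at x))"

definition test_functions :: "(real^'n \<Rightarrow> complex) set" where
  "test_functions = {\<phi>. smooth \<phi> \<and> periodic \<phi>}"

definition Ck_norm :: "nat \<Rightarrow> (real^'n \<Rightarrow> complex) \<Rightarrow> real" where
  "Ck_norm N \<phi> = (SUP (is, x) \<in> {is. length is \<le> N} \<times> UNIV. norm (partials is \<phi> x))"

text \<open>A functional on the space of test functions is represented by a function on all of
  \<open>real^'n \<Rightarrow> complex\<close> that is \<open>0\<close> outside of \<^const>\<open>test_functions\<close>. With this convention pointwise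
  equality, sum and difference are those of functionals on \<^const>\<open>test_functions\<close>. Continuity is
  with respect to the Frechet topology given by the norms \<^const>\<open>Ck_norm\<close>; pairings are bilinear.\<close>

type_synonym 'n functional = "(real^'n \<Rightarrow> complex) \<Rightarrow> complex"

definition distributions :: "('n::finite) functional set" where
  "distributions = {u.
     (\<forall>\<phi>. \<phi> \<notin> test_functions \<longrightarrow> u \<phi> = 0) \<and>
     (\<forall>\<phi>\<in>test_functions. \<forall>\<psi>\<in>test_functions. u (\<lambda>x. \<phi> x + \<psi> x) = u \<phi> + u \<psi>) \<and>
     (\<forall>c. \<forall>\<phi>\<in>test_functions. u (\<lambda>x. c * \<phi> x) = c * u \<phi>) \<and>
     (\<exists>C N. \<forall>\<phi>\<in>test_functions. norm (u \<phi>) \<le> C * Ck_norm N \<phi>)}"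

definition expo :: "int^'n \<Rightarrow> real^'n \<Rightarrow> complex" where
  "expo k x = exp (2 * of_real pi * \<i> * of_real (vec_of_int k \<bullet> x))"

definition fourier_coeff :: "('n::finite) functional \<Rightarrow> int^'n \<Rightarrow> complex" where
  "fourier_coeff u k = u (expo (- k))"

text \<open>The trigonometric series \<open>\<Sum>k. c k * expo k\<close>, as a functional: it pairs with \<open>\<phi>\<close> term by
  term. It is a distribution with Fourier coefficients \<open>c\<close> exactly when \<open>c\<close> has at most polynomial
  growth.\<close>

definition trig_series :: "(int^'n \<Rightarrow> complex) \<Rightarrow> ('n::finite) functional" where
  "trig_series c \<phi> = (if \<phi> \<in> test_functions
     then \<Sum>\<^sub>\<infinity>k\<in>UNIV. c k * integral (cbox 0 1) (\<lambda>x. expo k x * \<phi> x) else 0)"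

definition fourier_multiplier :: "(int^'n \<Rightarrow> real) \<Rightarrow> ('n::finite) functional \<Rightarrow> 'n functional" where
  "fourier_multiplier \<omega> u = trig_series (\<lambda>k. of_real (\<omega> k) * fourier_coeff u k)"

definition japanese :: "int^'n \<Rightarrow> real" where
  "japanese k = sqrt (1 + (norm (vec_of_int k))\<^sup>2)"

definition sobolev :: "real \<Rightarrow> ('n::finite) functional set" where
  "sobolev s = {u \<in> distributions.
     (\<lambda>k. japanese k powr (2 * s) * (norm (fourier_coeff u k))\<^sup>2) summable_on UNIV}"

definition sobolev_norm :: "real \<Rightarrow> ('n::finite) functional \<Rightarrow> real" where
  "sobolev_norm s u =
     sqrt (\<Sum>\<^sub>\<infinity>k\<in>UNIV. japanese k powr (2 * s) * (norm (fourier_coeff u k))\<^sup>2)"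

definition grassmannian :: "nat \<Rightarrow> (rat^'n) set set" where
  "grassmannian d = {A. vec.subspace A \<and> vec.dim A = d}"

definition vec_rat_of_int :: "int^'n \<Rightarrow> rat^'n" where
  "vec_rat_of_int k = (\<chi> i. of_int (k $ i))"

definition orthogonal_to :: "int^'n \<Rightarrow> (rat^'n) set \<Rightarrow> bool" where
  "orthogonal_to k A \<longleftrightarrow> (\<forall>v\<in>A. (\<Sum>i\<in>UNIV. of_int (k $ i) * v $ i) = 0)"

definition integer_basis :: "(rat^'n) set \<Rightarrow> (int^'n) list \<Rightarrow> bool" where
  "integer_basis A vs \<longleftrightarrow> distinct vs \<and> vec.independent (vec_rat_of_int ` set vs) \<and>
     vec.span (vec_rat_of_int ` set vs) = A"

text \<open>The integral over \<open>[0,1]\<^sup>d\<close>, where \<open>d\<close> is the length of the list.\<close>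

definition radon_fun :: "(int^'n) list \<Rightarrow> (real^'n \<Rightarrow> complex) \<Rightarrow> real^'n \<Rightarrow> complex" where
  "radon_fun vs \<phi> x =
     (\<integral>t. \<phi> (x + (\<Sum>i<length vs. t i *\<^sub>R vec_of_int (vs ! i)))
        \<partial>(\<Pi>\<^sub>M i\<in>{..<length vs}. restrict_space lborel {0..1}))"

definition radon_dist :: "(int^'n) list \<Rightarrow> ('n::finite) functional \<Rightarrow> 'n functional" where
  "radon_dist vs u \<phi> = (if \<phi> \<in> test_functions then u (radon_fun vs \<phi>) else 0)"

text \<open>On distributions, \<^const>\<open>radon_dist\<close> depends on the vectors only through their rational span,
  so any integer basis of \<open>A\<close> may be chosen.\<close>

definition radon :: "('n::finite) functional \<Rightarrow> (rat^'n) set \<Rightarrow> 'n functional" where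
  "radon u A = radon_dist (SOME vs. integer_basis A vs) u"

type_synonym 'n weight_fun = "int^'n \<Rightarrow> (rat^'n) set \<Rightarrow> real"

definition weight :: "nat \<Rightarrow> ('n::finite) weight_fun \<Rightarrow> bool" where
  "weight d w \<longleftrightarrow> (\<forall>A\<in>grassmannian d. (\<forall>k. w k A > 0) \<and>
     (\<exists>C>0. \<exists>N>0. \<forall>k. w k A \<ge> C * japanese k powr (- N)))"

definition Omega :: "nat \<Rightarrow> int^'n \<Rightarrow> (rat^'n) set set" where
  "Omega d k = {A \<in> grassmannian d. orthogonal_to k A}"

text \<open>A divergent sum has the value \<open>0\<close> here; a positive lower bound on \<open>W d w k\<close> thus includes
  convergence.\<close>

definition W :: "nat \<Rightarrow> ('n::finite) weight_fun \<Rightarrow> int^'n \<Rightarrow> real" where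
  "W d w k = (\<Sum>\<^sub>\<infinity>A\<in>Omega d k. (w k A)\<^sup>2)"

definition data_space :: "nat \<Rightarrow> real \<Rightarrow> ('n::finite) weight_fun \<Rightarrow> ((rat^'n) set \<Rightarrow> ('n::finite) functional) set" where
  "data_space d t w = {g.
     (\<forall>A\<in>grassmannian d. g A \<in> distributions \<and>
        fourier_multiplier (\<lambda>k. w k A) (g A) \<in> sobolev t) \<and>
     (\<lambda>A. (sobolev_norm t (fourier_multiplier (\<lambda>k. w k A) (g A)))\<^sup>2) summable_on grassmannian d}"

definition data_norm ::
  "nat \<Rightarrow> real \<Rightarrow> ('n::finite) weight_fun \<Rightarrow> ((rat^'n) set \<Rightarrow> ('n::finite) functional) \<Rightarrow> real" where
  "data_norm d t w g = sqrt (\<Sum>\<^sub>\<infinity>A\<in>grassmannian d.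
     (sobolev_norm t (fourier_multiplier (\<lambda>k. w k A) (g A)))\<^sup>2)"

text \<open>The adjoint of \<^const>\<open>radon\<close> from \<open>sobolev t\<close> to \<open>data_space d t w\<close>, which has this form for
  every \<open>t\<close>.\<close>

definition radon_adjoint ::
  "nat \<Rightarrow> ('n::finite) weight_fun \<Rightarrow> ((rat^'n) set \<Rightarrow> ('n::finite) functional) \<Rightarrow> 'n functional" where
  "radon_adjoint d w g = trig_series (\<lambda>k.
     \<Sum>\<^sub>\<infinity>A\<in>Omega d k. of_real ((w k A)\<^sup>2) * fourier_coeff (g A) k)"

definition tikhonov :: "nat \<Rightarrow> ('n::finite) weight_fun \<Rightarrow> real \<Rightarrow> real \<Rightarrow> ('n::finite) functional \<Rightarrow> 'n functional" where
  "tikhonov d w z \<alpha> =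
     fourier_multiplier (\<lambda>k. 1 / (W d w k + \<alpha> * japanese k powr (2 * z)))"

definition rate_const :: "real \<Rightarrow> real" where
  "rate_const x = x * (1 / x - 1) powr (1 - x)"

end

theory Submission
  imports Defs
begin

text \<open>On the Fourier side everything is diagonal. Since \<open>R\<^sub>d\<close> keeps the \<open>k\<close>-th coefficient if
  \<open>k \<bottom> A\<close> and kills it otherwise, the operator \<open>R\<^sub>d\<^sup>* R\<^sub>d\<close> has the symbol \<open>W\<^sub>k\<close>, and the error splits
  into the regularization error with symbol \<open>\<alpha>\<langle>k\<rangle>\<^bsup>2s\<^esup> / (W\<^sub>k + \<alpha>\<langle>k\<rangle>\<^bsup>2s\<^esup>)\<close> applied to \<open>f\<close> and the noise
  \<open>P R\<^sub>d\<^sup>* g\<close>. By Cauchy-Schwarz over \<open>\<Omega>\<^sub>k\<close> the noise is at most \<open>C\<^sub>w / \<alpha>\<close> times the norm of \<open>g\<close>; the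
  symbol of the regularization error is bounded by \<open>1\<close> and tends to \<open>0\<close> pointwise, so dominated
  convergence gives the limit, and maximizing \<open>y\<^bsup>1-x\<^esup> / (1 + y)\<close> with \<open>x = \<delta> / (2s)\<close> gives the rate.
  The regularized series is a distribution because the Fourier coefficients of test functions decay
  rapidly, by integration by parts on the torus.\<close>

section \<open>Periodic test functions\<close>

lemma partials_Nil [simp]: "partials [] \<phi> = \<phi>"
  by (simp add: partials_def)

lemma partials_Cons: "partials (i # is) \<phi> = partial i (partials is \<phi>)"
  by (simp add: partials_def)

lemma partials_append: "partials (is @ js) \<phi> = partials is (partials js \<phi>)"
  by (simp add: partials_def)

lemma partial_eq:
  assumes "(\<phi> has_derivative D) (at x)"
  shows "partial i \<phi> x = D (axis i 1)"
  using frechet_derivative_at[OF assms] by (simp add: partial_def)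

lemma test_functions_differentiable:
  "\<phi> \<in> test_functions \<Longrightarrow> partials is \<phi> differentiable (at x)"
  by (simp add: test_functions_def smooth_def)

text \<open>Translation by an integer vector leaves \<open>\<phi>\<close> unchanged, so by the chain
  rule the derivative at the translated point is also a derivative at \<open>x\<close>, and
  derivatives are unique.\<close>

lemma periodic_partial:
  fixes \<phi> :: "real^'n \<Rightarrow> complex"
  assumes per: "periodic \<phi>" and diff: "\<And>x. \<phi> differentiable (at x)"
  shows "periodic (partial i \<phi>)"
  unfolding periodic_def
proof (intro allI)
  fix k :: "int^'n" and x :: "real^'n"
  let ?D = "frechet_derivative \<phi> (at (x + vec_of_int k))"
  have "(\<phi> has_derivative ?D) (at (x + vec_of_int k))"
    using diff by (simp add: frechet_derivative_works)
  then have "((\<phi> \<circ> (\<lambda>y. y + vec_of_int k)) has_derivative ?D \<circ> (\<lambda>y. y)) (at x)"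
    by (intro diff_chain_at) (auto intro!: derivative_eq_intros)
  moreover have "\<phi> \<circ> (\<lambda>y. y + vec_of_int k) = \<phi>"
    using per by (auto simp: periodic_def)
  ultimately have "(\<phi> has_derivative ?D) (at x)"
    by (simp add: comp_def)
  then show "partial i \<phi> (x + vec_of_int k) = partial i \<phi> x"
    by (simp add: partial_eq) (simp add: partial_def)
qed

lemma periodic_partials:
  assumes "\<phi> \<in> test_functions"
  shows "periodic (partials is \<phi>)"
proof (induction "is")
  case Nil
  show ?case using assms by (simp add: test_functions_def)
next
  case (Cons i "is")
  then show ?case
    using assms by (simp add: partials_Cons periodic_partial test_functions_differentiable)
qed

lemma test_functions_partials:
  assumes "\<phi> \<in> test_functions"
  shows "partials is \<phi> \<in> test_functions"
  using assms periodic_partials[OF assms]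
  by (simp add: test_functions_def smooth_def flip: partials_append)

lemma test_functions_continuous:
  assumes "\<phi> \<in> test_functions"
  shows "continuous_on S \<phi>"
  using test_functions_differentiable[OF assms, of "[]"]
  by (simp add: continuous_at_imp_continuous_on differentiable_imp_continuous_within)

text \<open>Subtracting the integer parts of the coordinates moves any point into the compact unit
  cube without changing the value.\<close>

lemma periodic_bounded:
  fixes \<phi> :: "real^'n \<Rightarrow> complex"
  assumes "periodic \<phi>" and "continuous_on UNIV \<phi>"
  obtains B where "\<And>x. norm (\<phi> x) \<le> B"
proof -
  have "compact (\<phi> ` cbox 0 1)"
    using assms(2) by (intro compact_continuous_image) (auto intro: continuous_on_subset)
  then obtain B where B: "\<And>x. x \<in> cbox 0 1 \<Longrightarrow> norm (\<phi> x) \<le> B"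
    by (meson bounded_iff compact_imp_bounded image_eqI)
  have "norm (\<phi> x) \<le> B" for x
  proof -
    define k :: "int^'n" where "k = (\<chi> i. - \<lfloor>x $ i\<rfloor>)"
    have "x + vec_of_int k \<in> cbox 0 1"
      by (auto simp: mem_box_cart k_def vec_of_int_def) linarith+
    with B assms(1) show ?thesis
      by (metis periodic_def)
  qed
  with that show ?thesis by blast
qed

section \<open>Finiteness and monotonicity of the norms \<open>Ck_norm N\<close>\<close>

text \<open>A real supremum is only meaningful for a bounded set. Each iterated partial is bounded
  by periodicity, and there are finitely many index lists of length at most \<open>N\<close>, so the
  sum of the individual bounds serves for all.\<close>

lemma Ck_norm_bdd_above:
  fixes \<phi> :: "real^'n \<Rightarrow> complex"
  assumes "\<phi> \<in> test_functions"
  shows "bdd_above ((\<lambda>(is, x). norm (partials is \<phi> x)) ` ({is. length is \<le> N} \<times> UNIV))"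
proof -
  have "\<exists>B. \<forall>x. norm (partials is \<phi> x) \<le> B" for "is"
    using periodic_bounded[OF periodic_partials[OF assms]
        test_functions_continuous[OF test_functions_partials[OF assms]]] by metis
  then obtain B where B: "\<And>is x. norm (partials is \<phi> x) \<le> B is"
    by metis
  have fin: "finite {is :: 'n list. length is \<le> N}"
    using finite_lists_length_le[of "UNIV :: 'n set"] by simp
  have "norm (partials is \<phi> x) \<le> (\<Sum>js\<in>{js. length js \<le> N}. \<bar>B js\<bar>)" if "length is \<le> N" for "is" x
  proof -
    have "norm (partials is \<phi> x) \<le> \<bar>B is\<bar>"
      using B by (meson abs_ge_self order_trans)
    also have "\<dots> \<le> (\<Sum>js\<in>{js. length js \<le> N}. \<bar>B js\<bar>)"
      using that fin by (intro member_le_sum) auto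
    finally show ?thesis .
  qed
  then show ?thesis
    by (auto intro!: bdd_aboveI)
qed

lemma norm_partials_le_Ck_norm:
  assumes "\<phi> \<in> test_functions" and "length is \<le> N"
  shows "norm (partials is \<phi> x) \<le> Ck_norm N \<phi>"
  unfolding Ck_norm_def
  using cSUP_upper[OF _ Ck_norm_bdd_above[OF assms(1)], of "(is, x)" N] assms(2) by auto

lemma Ck_norm_nonneg:
  assumes "\<phi> \<in> test_functions"
  shows "Ck_norm N \<phi> \<ge> 0"
  using order_trans[OF norm_ge_zero norm_partials_le_Ck_norm[OF assms, of "[]" N 0]] by simp

lemma Ck_norm_mono:
  assumes "\<phi> \<in> test_functions" and "M \<le> N"
  shows "Ck_norm M \<phi> \<le> Ck_norm N \<phi>"
  unfolding Ck_norm_def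
  using assms by (intro cSUP_subset_mono Ck_norm_bdd_above) (auto intro: exI[of _ "[]"])

lemma partials_add:
  assumes "\<phi> \<in> test_functions" and "\<psi> \<in> test_functions"
  shows "partials is (\<lambda>x. \<phi> x + \<psi> x) = (\<lambda>x. partials is \<phi> x + partials is \<psi> x)"
proof (induction "is")
  case (Cons i "is")
  have "partial i (\<lambda>x. partials is \<phi> x + partials is \<psi> x) x
      = partial i (partials is \<phi>) x + partial i (partials is \<psi>) x" for x
    using assms[THEN test_functions_differentiable, of "is" x, unfolded frechet_derivative_works]
    by (subst partial_eq[OF has_derivative_add]) (auto simp: partial_def)
  with Cons show ?case by (simp add: partials_Cons)
qed simp

lemma partials_cmult:
  assumes "\<phi> \<in> test_functions"
  shows "partials is (\<lambda>x. c * \<phi> x) = (\<lambda>x. c * partials is \<phi> x)"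
proof (induction "is")
  case (Cons i "is")
  have "partial i (\<lambda>x. c * partials is \<phi> x) x = c * partial i (partials is \<phi>) x" for x
    using assms[THEN test_functions_differentiable, of "is" x, unfolded frechet_derivative_works]
    by (subst partial_eq[OF has_derivative_mult_right]) (auto simp: partial_def)
  with Cons show ?case by (simp add: partials_Cons)
qed simp

lemma test_functions_add:
  assumes "\<phi> \<in> test_functions" and "\<psi> \<in> test_functions"
  shows "(\<lambda>x. \<phi> x + \<psi> x) \<in> test_functions"
  using assms test_functions_differentiable[OF assms(1)] test_functions_differentiable[OF assms(2)]
  by (auto simp: test_functions_def smooth_def periodic_def partials_add intro!: differentiable_add)

lemma test_functions_cmult:
  assumes "\<phi> \<in> test_functions"
  shows "(\<lambda>x. c * \<phi> x) \<in> test_functions"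
  using assms test_functions_differentiable[OF assms]
  by (auto simp: test_functions_def smooth_def periodic_def partials_cmult intro!: differentiable_mult)

section \<open>Exponentials as test functions\<close>

lemma vec_of_int_inner:
  "vec_of_int k \<bullet> vec_of_int m = of_int (\<Sum>i\<in>UNIV. k $ i * m $ i)"
  by (simp add: inner_vec_def vec_of_int_def)

lemma expo_add: "expo k (x + y) = expo k x * expo k y"
  by (simp add: expo_def inner_add_right distrib_left exp_add)

lemma expo_vec_of_int: "expo k (vec_of_int m) = 1"
proof -
  have "expo k (vec_of_int m) = exp ((2 * of_int (\<Sum>i\<in>UNIV. k $ i * m $ i) * pi) * \<i>)"
    unfolding expo_def vec_of_int_inner by (simp add: mult_ac)
  also have "\<dots> = 1"
    by (rule exp_integer_2pi) auto
  finally show ?thesis .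
qed

lemma norm_expo [simp]: "norm (expo k x) = 1"
  by (simp add: expo_def)

lemma expo_0 [simp]: "expo 0 = (\<lambda>_. 1)"
  by (simp add: fun_eq_iff expo_def vec_of_int_def zero_vec_def[symmetric])

lemma expo_mult: "expo j x * expo k x = expo (j + k) x"
proof -
  have "vec_of_int (j + k) = vec_of_int j + vec_of_int k"
    by (simp add: vec_of_int_def vec_eq_iff)
  then show ?thesis
    by (simp add: expo_def inner_add_left distrib_left exp_add)
qed

lemma has_derivative_expo:
  "(expo k has_derivative (\<lambda>h. 2 * of_real pi * \<i> * of_real (vec_of_int k \<bullet> h) * expo k x)) (at x)"
proof -
  have "((\<lambda>x. 2 * of_real pi * \<i> * of_real (vec_of_int k \<bullet> x) :: complex) has_derivative
      (\<lambda>h. 2 * of_real pi * \<i> * of_real (vec_of_int k \<bullet> h))) (at x)"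
    by (intro has_derivative_mult_right has_derivative_of_real has_derivative_inner_right has_derivative_ident)
  from diff_chain_at[OF this DERIV_exp[unfolded has_field_derivative_def]]
  show ?thesis
    by (simp add: comp_def expo_def[abs_def] mult_ac)
qed

lemma vec_of_int_inner_axis: "vec_of_int k \<bullet> axis i 1 = of_int (k $ i)"
  by (simp add: inner_axis vec_of_int_def)

text \<open>Each partial derivative multiplies \<open>expo k\<close> by a constant, so all iterated
  partials are scalar multiples of \<open>expo k\<close>.\<close>

lemma expo_test_function [intro]: "expo k \<in> test_functions"
proof -
  have "\<exists>c. partials is (expo k) = (\<lambda>x. c * expo k x)" for "is"
  proof (induction "is")
    case Nil
    show ?case by (rule exI[of _ 1]) simp
  next
    case (Cons i "is")
    then obtain c where c: "partials is (expo k) = (\<lambda>x. c * expo k x)" by blast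
    have "partials (i # is) (expo k) x = c * (2 * of_real pi * \<i> * of_int (k $ i) * expo k x)" for x
      unfolding partials_Cons c
      by (subst partial_eq[OF has_derivative_mult_right[OF has_derivative_expo]])
        (simp add: vec_of_int_inner_axis)
    then show ?case
      by (intro exI[of _ "c * (2 * of_real pi * \<i> * of_int (k $ i))"]) (simp add: fun_eq_iff mult_ac)
  qed
  moreover have "(\<lambda>x. c * expo k x) differentiable (at x)" for c x
    using has_derivative_mult_right[OF has_derivative_expo] differentiableI by blast
  ultimately have "smooth (expo k)"
    unfolding smooth_def by metis
  then show ?thesis
    by (simp add: test_functions_def periodic_def expo_add expo_vec_of_int)
qed

section \<open>Integration by parts on the torus and orthogonality of exponentials\<close>

text \<open>The slab of the shifted cube that sticks out of the unit cube is moved to the opposite face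
  by periodicity.\<close>

lemma integral_periodic_shift:
  fixes \<psi> :: "real^'n \<Rightarrow> complex"
  assumes per: "periodic \<psi>" and cont: "continuous_on UNIV \<psi>" and h: "h \<in> {0..1}"
  shows "integral (cbox 0 1) (\<lambda>x. \<psi> (x + h *\<^sub>R axis i 1)) = integral (cbox 0 1) \<psi>"
proof -
  \<comment> \<open>The unit cube with its \<open>i\<close>-th side replaced by the interval from
    \<open>u\<close> to \<open>v\<close>; a shift along \<open>axis i 1\<close> only moves these two
    bounds.\<close>
  define Q where "Q u v = cbox (\<chi> j. if j = i then u else 0) (\<chi> j. if j = i then v else (1::real))" for u v
  have mem_Q: "x \<in> Q u v \<longleftrightarrow> u \<le> x $ i \<and> x $ i \<le> v \<and> (\<forall>j. j \<noteq> i \<longrightarrow> 0 \<le> x $ j \<and> x $ j \<le> 1)" for x u v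
    by (auto simp: Q_def mem_box_cart)
  have int: "\<psi> integrable_on Q u v" for u v
    unfolding Q_def using cont by (intro integrable_continuous continuous_on_subset[OF cont]) auto
  have Q_split: "integral (Q u v) \<psi> = integral (Q u m) \<psi> + integral (Q m v) \<psi>"
    if "u \<le> m" "m \<le> v" for u m v
  proof -
    have "axis i 1 \<in> (Basis :: (real^'n) set)"
      by (simp add: axis_in_Basis_iff)
    then have "integral (Q u v) \<psi> = integral (Q u v \<inter> {x. x \<bullet> axis i 1 \<le> m}) \<psi>
        + integral (Q u v \<inter> {x. x \<bullet> axis i 1 \<ge> m}) \<psi>"
      using int[of u v] unfolding Q_def by (intro integral_split) auto
    moreover have "Q u v \<inter> {x. x \<bullet> axis i 1 \<le> m} = Q u m" "Q u v \<inter> {x. x \<bullet> axis i 1 \<ge> m} = Q m v"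
      using that by (auto simp: set_eq_iff mem_Q inner_axis)
    ultimately show ?thesis by simp
  qed
  have shift: "integral (Q u v) (\<lambda>x. \<psi> (x + c *\<^sub>R axis i 1)) = integral (Q (u + c) (v + c)) \<psi>" for u v c
  proof -
    have "(\<chi> j. if j = i then p + c else q) = (\<chi> j. if j = i then p else q) + c *\<^sub>R axis i 1" for p q
      by (simp add: vec_eq_iff axis_def)
    then show ?thesis
      using integral_shift_cbox_plus[of _ _ \<psi> "c *\<^sub>R axis i 1"]
      unfolding Q_def by (simp add: comp_def add.commute)
  qed
  have "vec_of_int (axis i 1) = (axis i 1 :: real^'n)"
    by (simp add: vec_of_int_def vec_eq_iff axis_def)
  then have "\<psi> (x + axis i 1) = \<psi> x" for x
    using per[unfolded periodic_def, rule_format, of x "axis i 1"] by simp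
  then have "integral (Q 1 (1 + h)) \<psi> = integral (Q 0 h) \<psi>"
    using shift[of 0 h 1] by (simp add: add.commute)
  \<comment> \<open>Cut the shifted cube at height 1 and the unit cube at height \<open>h\<close>:
    they share the piece from \<open>h\<close> to 1, and the two remaining slabs have equal
    integrals.\<close>
  then have "integral (Q h (1 + h)) \<psi> = integral (Q 0 1) \<psi>"
    using Q_split[of h 1 "1 + h"] Q_split[of 0 h 1] h by simp
  moreover have "Q 0 1 = cbox 0 1"
    unfolding Q_def by (intro arg_cong2[where f = cbox]) (auto simp: vec_eq_iff)
  ultimately show ?thesis
    using shift[of 0 1 h] by simp
qed

text \<open>The integral of the translate by \<open>h\<close> along axis \<open>i\<close> does not
  depend on \<open>h\<close>, so its derivative at 0 vanishes; by the Leibniz rule this derivative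
  is the integral of the partial. One-sided derivatives on the unit interval suffice and match the
  range of shifts covered by \<open>integral_periodic_shift\<close>.\<close>

lemma integral_partial_periodic:
  fixes \<psi> :: "real^'n \<Rightarrow> complex"
  assumes per: "periodic \<psi>" and diff: "\<And>x. \<psi> differentiable (at x)"
    and cont: "continuous_on UNIV (partial i \<psi>)"
  shows "integral (cbox 0 1) (partial i \<psi>) = 0"
proof -
  let ?F = "\<lambda>h. integral (cbox 0 1) (\<lambda>x. \<psi> (x + h *\<^sub>R axis i 1))"
  have cont': "continuous_on UNIV \<psi>"
    using diff by (simp add: continuous_at_imp_continuous_on differentiable_imp_continuous_within)
  have deriv: "((\<lambda>h. \<psi> (x + h *\<^sub>R axis i 1)) has_vector_derivative
      partial i \<psi> (x + h *\<^sub>R axis i 1)) (at h within {0..1})" for h x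
  proof -
    let ?D = "frechet_derivative \<psi> (at (x + h *\<^sub>R axis i 1))"
    have D: "(\<psi> has_derivative ?D) (at (x + h *\<^sub>R axis i 1))"
      using diff by (simp add: frechet_derivative_works)
    have "((\<psi> \<circ> (\<lambda>h. x + h *\<^sub>R axis i 1)) has_derivative ?D \<circ> (\<lambda>h. h *\<^sub>R axis i 1)) (at h)"
      using D by (intro diff_chain_at) (auto intro!: derivative_eq_intros)
    moreover have "?D \<circ> (\<lambda>u. u *\<^sub>R axis i 1) = (\<lambda>u. u *\<^sub>R partial i \<psi> (x + h *\<^sub>R axis i 1))"
      using linear_scale[OF has_derivative_linear[OF D]] by (simp add: fun_eq_iff partial_def)
    ultimately show ?thesis
      by (simp add: has_vector_derivative_def comp_def has_derivative_at_withinI)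
  qed
  have "(?F has_vector_derivative integral (cbox 0 1) (\<lambda>x. partial i \<psi> (x + 0 *\<^sub>R axis i 1)))
      (at 0 within {0..1})"
  proof (rule leibniz_rule_vector_derivative)
    show "(\<lambda>x. \<psi> (x + h *\<^sub>R axis i 1)) integrable_on cbox 0 1" for h
      by (intro integrable_continuous continuous_on_compose2[OF cont'] continuous_intros) auto
    show "continuous_on ({0..1} \<times> cbox 0 1) (\<lambda>(h, x). partial i \<psi> (x + h *\<^sub>R axis i 1))"
      unfolding split_beta
      by (intro continuous_on_compose2[OF cont] continuous_intros) auto
  qed (use deriv in auto)
  moreover have "(?F has_vector_derivative 0) (at 0 within {0..1})"
  proof (rule has_vector_derivative_transform)
    show "((\<lambda>_. integral (cbox 0 1) \<psi>) has_vector_derivative 0) (at 0 within {0..1})"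
      by (rule has_vector_derivative_const)
  qed (use integral_periodic_shift[OF per cont'] in auto)
  ultimately show ?thesis
    using vector_derivative_unique_within_closed_interval[of 0 1 0 ?F] by auto
qed

text \<open>Integration by parts: the product of \<open>expo k\<close> and \<open>\<phi>\<close> is
  periodic, so the integral of its partial derivative vanishes and the boundary terms
  disappear.\<close>

lemma integral_expo_partial:
  assumes "\<phi> \<in> test_functions"
  shows "integral (cbox 0 1) (\<lambda>x. expo k x * partial i \<phi> x)
    = - (2 * of_real pi * \<i> * of_int (k $ i)) * integral (cbox 0 1) (\<lambda>x. expo k x * \<phi> x)"
proof -
  let ?c = "2 * of_real pi * \<i> * of_int (k $ i) :: complex"
  note test = test_functions_partials[OF assms]
  have D: "((\<lambda>x. expo k x * \<phi> x) has_derivative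
      (\<lambda>h. expo k x * frechet_derivative \<phi> (at x) h +
        2 * of_real pi * \<i> * of_real (vec_of_int k \<bullet> h) * expo k x * \<phi> x)) (at x)" for x
    using test_functions_differentiable[OF assms, of "[]" x] has_derivative_expo
    by (intro has_derivative_mult) (simp_all add: frechet_derivative_works)
  have eq: "partial i (\<lambda>x. expo k x * \<phi> x) = (\<lambda>x. expo k x * partial i \<phi> x + ?c * (expo k x * \<phi> x))"
    by (simp add: fun_eq_iff partial_eq[OF D] vec_of_int_inner_axis partial_def)
  have conts: "continuous_on S (expo k)" "continuous_on S \<phi>" "continuous_on S (partial i \<phi>)" for S
    using test[of "[]"] test[of "[i]"]
    by (auto simp: partials_Cons intro!: test_functions_continuous)
  have "0 = integral (cbox 0 1) (partial i (\<lambda>x. expo k x * \<phi> x))"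
  proof (rule integral_partial_periodic[symmetric])
    show "periodic (\<lambda>x. expo k x * \<phi> x)"
      using assms expo_test_function[of k] by (simp add: test_functions_def periodic_def)
    show "(\<lambda>x. expo k x * \<phi> x) differentiable (at x)" for x
      using D differentiableI by blast
    show "continuous_on UNIV (partial i (\<lambda>x. expo k x * \<phi> x))"
      unfolding eq by (intro continuous_intros conts)
  qed
  also have "\<dots> = integral (cbox 0 1) (\<lambda>x. expo k x * partial i \<phi> x)
      + integral (cbox 0 1) (\<lambda>x. ?c * (expo k x * \<phi> x))"
    unfolding eq by (intro integral_add integrable_continuous continuous_intros conts)
  finally show ?thesis
    by (simp add: eq_neg_iff_add_eq_0)
qed

text \<open>For \<open>k \<noteq> 0\<close> choose a nonzero component \<open>k $ i\<close> and
  integrate by parts against the constant 1: its partial is 0, hence so is the nonzero factor times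
  the integral.\<close>

lemma integral_expo:
  fixes k :: "int^'n"
  shows "integral (cbox 0 1) (expo k) = (if k = 0 then 1 else 0)"
proof (cases "k = 0")
  case True
  have "measure lborel (cbox 0 (1 :: real^'n)) = 1"
    by (subst content_cbox_cart) (auto simp: interval_ne_empty_cart)
  then show ?thesis using True by simp
next
  case False
  then obtain i where i: "k $ i \<noteq> 0" by (auto simp: vec_eq_iff)
  have one: "(\<lambda>_. 1) \<in> (test_functions :: (real^'n \<Rightarrow> complex) set)"
    using expo_test_function[of 0] by simp
  have "partial i (\<lambda>_::real^'n. 1::complex) = (\<lambda>_. 0)"
    by (simp add: fun_eq_iff partial_eq[OF has_derivative_const])
  then have "2 * of_real pi * \<i> * of_int (k $ i) * integral (cbox 0 1) (expo k) = 0"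
    using integral_expo_partial[OF one, of k i] by simp
  with i False show ?thesis by simp
qed

section \<open>Trigonometric series\<close>

lemma vec_of_int_norm: "(norm (vec_of_int k :: real^'n))\<^sup>2 = (\<Sum>i\<in>UNIV. (real_of_int (k $ i))\<^sup>2)"
  unfolding power2_norm_eq_inner by (simp add: inner_vec_def vec_of_int_def power2_eq_square)

lemma japanese_power2: "(japanese (k :: int^'n))\<^sup>2 = 1 + (\<Sum>i\<in>UNIV. (real_of_int (k $ i))\<^sup>2)"
  unfolding japanese_def vec_of_int_norm by (simp add: add_nonneg_nonneg sum_nonneg)

lemma japanese_ge_1: "japanese k \<ge> 1"
  by (simp add: japanese_def)

lemma japanese_pos [simp]: "japanese k > 0"
  using japanese_ge_1[of k] by linarith

lemma japanese_nonzero [simp]: "japanese k \<noteq> 0"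
  using japanese_pos[of k] by linarith

lemma summable_on_inverse_int_square: "(\<lambda>y::int. 1 / (1 + (real_of_int y)\<^sup>2)) summable_on UNIV"
proof -
  let ?f = "\<lambda>y::int. 1 / (1 + (real_of_int y)\<^sup>2)"
  have "summable (\<lambda>n::nat. inverse (real n ^ 2))"
    using inverse_power_summable[of 2, where 'a = real] by simp
  then have "summable (\<lambda>n::nat. 1 / (1 + (real n)\<^sup>2))"
    by (rule summable_comparison_test'[where N = 1])
      (auto simp: inverse_eq_divide add_nonneg_nonneg intro!: divide_left_mono mult_pos_pos add_pos_nonneg)
  then have nat: "(\<lambda>n::nat. 1 / (1 + (real n)\<^sup>2)) summable_on UNIV"
    by (rule summable_nonneg_imp_summable_on) (simp add: add_nonneg_nonneg)
  have "?f summable_on range int" "?f summable_on range (\<lambda>n. - int n)"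
    using nat by (subst summable_on_reindex; simp add: inj_on_def comp_def)+
  then have "?f summable_on (range int \<union> range (\<lambda>n. - int n))"
    by (rule summable_on_union)
  moreover have "range int \<union> range (\<lambda>n. - int n) = UNIV"
    using int_cases2 by (auto simp: image_iff) metis
  ultimately show ?thesis by simp
qed

text \<open>The exponent is chosen for ease: the square of \<open>japanese k\<close> dominates each
  \<open>1 + (k $ i)^2\<close>, so the summand is at most a product of one-dimensional terms and the
  lattice sum is controlled by a power of a sum over the integers.\<close>

lemma summable_on_japanese:
  "(\<lambda>k::int^'n. 1 / japanese k ^ (2 * CARD('n))) summable_on UNIV"
proof (rule nonneg_bdd_above_summable_on)
  let ?f = "\<lambda>y::int. 1 / (1 + (real_of_int y)\<^sup>2)"
  show "bdd_above (sum (\<lambda>k::int^'n. 1 / japanese k ^ (2 * CARD('n))) ` {F. F \<subseteq> UNIV \<and> finite F})"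
  proof (rule bdd_aboveI2)
    fix F :: "(int^'n) set" assume "F \<in> {F. F \<subseteq> UNIV \<and> finite F}"
    then have F: "finite F" by simp
    \<comment> \<open>The \<open>i\<close>-th coordinates that occur in \<open>F\<close>. Enlarging
      \<open>F\<close> to the box \<open>PiE UNIV B\<close> lets the sum of products factor.\<close>
    define B where "B i = (\<lambda>k. k $ i) ` F" for i :: 'n
    have fin: "finite (B i)" for i
      using F by (simp add: B_def)
    have "(\<Sum>k\<in>F. 1 / japanese k ^ (2 * CARD('n))) \<le> (\<Sum>k\<in>F. \<Prod>i\<in>UNIV. ?f (k $ i))"
    proof (rule sum_mono)
      fix k :: "int^'n"
      have "(\<Prod>i\<in>UNIV. 1 + (real_of_int (k $ i))\<^sup>2) \<le> (\<Prod>i\<in>(UNIV :: 'n set). (japanese k)\<^sup>2)"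
        unfolding japanese_power2
        by (intro prod_mono) (auto intro!: member_le_sum add_nonneg_nonneg)
      also have "\<dots> = japanese k ^ (2 * CARD('n))"
        by (simp add: power_mult)
      finally have "1 / japanese k ^ (2 * CARD('n)) \<le> 1 / (\<Prod>i\<in>UNIV. 1 + (real_of_int (k $ i))\<^sup>2)"
        by (intro divide_left_mono mult_pos_pos prod_pos) (auto simp: add_pos_nonneg)
      then show "1 / japanese k ^ (2 * CARD('n)) \<le> (\<Prod>i\<in>UNIV. ?f (k $ i))"
        by (simp add: prod_dividef)
    qed
    also have "\<dots> = (\<Sum>g\<in>vec_nth ` F. \<Prod>i\<in>UNIV. ?f (g i))"
      by (subst sum.reindex) (auto simp: inj_on_def vec_nth_inject)
    also have "\<dots> \<le> (\<Sum>g\<in>PiE UNIV B. \<Prod>i\<in>UNIV. ?f (g i))"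
      using fin F by (intro sum_mono2 finite_PiE) (auto simp: B_def intro!: prod_nonneg add_nonneg_nonneg)
    also have "\<dots> = (\<Prod>i\<in>UNIV. \<Sum>y\<in>B i. ?f y)"
      using fin by (subst prod_sum_PiE) auto
    also have "\<dots> \<le> (\<Prod>i\<in>(UNIV :: 'n set). infsum ?f UNIV)"
      using fin by (intro prod_mono conjI sum_nonneg finite_sum_le_infsum summable_on_inverse_int_square)
        (auto intro!: add_nonneg_nonneg)
    finally show "(\<Sum>k\<in>F. 1 / japanese k ^ (2 * CARD('n))) \<le> infsum ?f UNIV ^ CARD('n)"
      by simp
  qed
qed (simp add: less_imp_le)

section \<open>Decay of the Fourier coefficients of test functions\<close>

lemma integral_expo_partials_replicate:
  assumes "\<phi> \<in> test_functions"
  shows "integral (cbox 0 1) (\<lambda>x. expo k x * partials (replicate M i) \<phi> x)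
    = (- (2 * of_real pi * \<i> * of_int (k $ i))) ^ M * integral (cbox 0 1) (\<lambda>x. expo k x * \<phi> x)"
proof (induction M)
  case (Suc M)
  then show ?case
    using integral_expo_partial[OF test_functions_partials[OF assms], of k i "replicate M i"]
    by (simp add: partials_Cons)
qed simp

lemma norm_integral_expo_partials:
  fixes \<phi> :: "real^'n \<Rightarrow> complex"
  assumes "\<phi> \<in> test_functions" and "length is \<le> N"
  shows "norm (integral (cbox 0 1) (\<lambda>x. expo k x * partials is \<phi> x)) \<le> Ck_norm N \<phi>"
proof -
  have "norm (integral (cbox 0 1) (\<lambda>x. expo k x * partials is \<phi> x))
      \<le> integral (cbox 0 (1 :: real^'n)) (\<lambda>_. Ck_norm N \<phi>)"
  proof (rule integral_norm_bound_integral)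
    show "(\<lambda>x. expo k x * partials is \<phi> x) integrable_on cbox 0 1"
      by (intro integrable_continuous continuous_intros test_functions_continuous
          expo_test_function test_functions_partials assms)
  qed (use assms in \<open>auto simp: norm_mult norm_partials_le_Ck_norm\<close>)
  also have "\<dots> = Ck_norm N \<phi>"
    by (simp add: content_cbox_cart interval_ne_empty_cart)
  finally show ?thesis .
qed

text \<open>Integrate by parts \<open>M\<close> times in the direction of the largest component of \<open>k\<close>.\<close>

lemma norm_integral_expo_decay:
  fixes \<phi> :: "real^'n \<Rightarrow> complex"
  assumes "\<phi> \<in> test_functions"
  shows "norm (integral (cbox 0 1) (\<lambda>x. expo k x * \<phi> x)) * japanese k ^ M
    \<le> sqrt (1 + real CARD('n)) ^ M * Ck_norm M \<phi>"
proof (cases "k = 0")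
  \<comment> \<open>At \<open>k = 0\<close> the weight is 1 and integration by parts gains nothing,
    so the sup bound is used directly.\<close>
  case True
  have "norm (integral (cbox 0 1) (\<lambda>x. expo k x * \<phi> x)) * 1 ^ M
    \<le> Ck_norm M \<phi>"
    using norm_integral_expo_partials[OF assms, of "[]" M k] by simp
  also have "\<dots> \<le> sqrt (1 + real CARD('n)) ^ M * Ck_norm M \<phi>"
    using Ck_norm_nonneg[OF assms, of M] by (simp add: mult_le_cancel_right1 one_le_power)
  finally show ?thesis
    using True by (simp add: japanese_def vec_of_int_def zero_vec_def[symmetric])
next
  case False
  obtain i where i: "\<And>j. \<bar>k $ j\<bar> \<le> \<bar>k $ i\<bar>"
  proof -
    have "Max (range (\<lambda>j. \<bar>k $ j\<bar>)) \<in> range (\<lambda>j. \<bar>k $ j\<bar>)"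
      by (intro Max_in) auto
    then obtain i where "Max (range (\<lambda>j. \<bar>k $ j\<bar>)) = \<bar>k $ i\<bar>"
      by (rule rangeE)
    moreover have "\<bar>k $ j\<bar> \<le> Max (range (\<lambda>j. \<bar>k $ j\<bar>))" for j
      by (intro Max_ge) auto
    ultimately show ?thesis
      using that[of i] by simp
  qed
  have "k $ i \<noteq> 0"
    using i False by (auto simp: vec_eq_iff)
  then have "1 \<le> \<bar>real_of_int (k $ i)\<bar>"
    by (simp flip: of_int_abs)
  then have "1 \<le> (real_of_int (k $ i))\<^sup>2"
    using one_le_power[of "\<bar>real_of_int (k $ i)\<bar>" 2] by simp
  moreover have "(\<Sum>j\<in>UNIV. (real_of_int (k $ j))\<^sup>2) \<le> real CARD('n) * (real_of_int (k $ i))\<^sup>2"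
    using i by (intro sum_bounded_above) (simp add: abs_le_square_iff[symmetric] flip: of_int_abs)
  \<comment> \<open>Since \<open>k $ i\<close> has modulus at least 1, the summand 1 of the squared
    weight is also at most \<open>(k $ i)^2\<close>; this accounts for the constant 1 + n.\<close>
  ultimately have "(japanese k)\<^sup>2 \<le> (1 + real CARD('n)) * \<bar>real_of_int (k $ i)\<bar>\<^sup>2"
    unfolding japanese_power2 by (simp add: algebra_simps)
  then have "japanese k \<le> sqrt (1 + real CARD('n)) * \<bar>real_of_int (k $ i)\<bar>"
    by (rule power2_le_imp_le[OF order_trans]) (simp_all add: power_mult_distrib)
  \<comment> \<open>Inserting 2 pi enlarges the bound and produces exactly the modulus of the factor
    gained by one integration by parts.\<close>
  also have "\<dots> \<le> sqrt (1 + real CARD('n)) * (2 * pi * \<bar>real_of_int (k $ i)\<bar>)"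
    using pi_gt3 by (intro mult_left_mono) (auto simp: mult_le_cancel_right1)
  finally have "japanese k ^ M \<le> (sqrt (1 + real CARD('n)) * (2 * pi * \<bar>real_of_int (k $ i)\<bar>)) ^ M"
    by (rule power_mono) (simp add: less_imp_le)
  also note power_mult_distrib
  finally have "norm (integral (cbox 0 1) (\<lambda>x. expo k x * \<phi> x)) * japanese k ^ M
      \<le> norm (integral (cbox 0 1) (\<lambda>x. expo k x * \<phi> x)) *
        (sqrt (1 + real CARD('n)) ^ M * (2 * pi * \<bar>real_of_int (k $ i)\<bar>) ^ M)"
    by (intro mult_left_mono) auto
  also have "\<dots> = sqrt (1 + real CARD('n)) ^ M *
      norm (integral (cbox 0 1) (\<lambda>x. expo k x * partials (replicate M i) \<phi> x))"
    by (simp add: integral_expo_partials_replicate[OF assms] norm_mult norm_power)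
  also have "\<dots> \<le> sqrt (1 + real CARD('n)) ^ M * Ck_norm M \<phi>"
    by (intro mult_left_mono norm_integral_expo_partials assms) auto
  finally show ?thesis .
qed

section \<open>Trigonometric series with coefficients of polynomial growth\<close>

text \<open>Of the \<open>N + 2n\<close> orders of decay of the test function, \<open>N\<close>
  absorb the growth of the coefficient and \<open>2n\<close> remain for summability over the
  lattice.\<close>

lemma trig_series_term_bound:
  fixes k :: "int^'n"
  assumes c: "norm c \<le> C * japanese k ^ N" and \<phi>: "\<phi> \<in> test_functions"
  shows "norm (c * integral (cbox 0 1) (\<lambda>x. expo k x * \<phi> x))
    \<le> C * sqrt (1 + real CARD('n)) ^ (N + 2 * CARD('n)) * Ck_norm (N + 2 * CARD('n)) \<phi>
      * (1 / japanese k ^ (2 * CARD('n)))"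
proof -
  let ?M = "N + 2 * CARD('n)" and ?I = "integral (cbox 0 1) (\<lambda>x. expo k x * \<phi> x)"
  have C: "C \<ge> 0"
    using order_trans[OF norm_ge_zero c] zero_less_power[OF japanese_pos[of k], of N]
    by (auto simp: zero_le_mult_iff)
  have "norm (c * ?I) \<le> C * japanese k ^ N * norm ?I"
    unfolding norm_mult by (intro mult_right_mono c) auto
  also have "\<dots> = C * (norm ?I * japanese k ^ ?M) / japanese k ^ (2 * CARD('n))"
    by (simp add: power_add)
  also have "\<dots> \<le> C * (sqrt (1 + real CARD('n)) ^ ?M * Ck_norm ?M \<phi>) / japanese k ^ (2 * CARD('n))"
    using C by (intro divide_right_mono mult_left_mono norm_integral_expo_decay \<phi>) (auto simp: less_imp_le)
  finally show ?thesis by (simp add: mult_ac)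
qed

lemma trig_series_abs_summable:
  fixes c :: "int^'n \<Rightarrow> complex"
  assumes "\<And>k. norm (c k) \<le> C * japanese k ^ N" and "\<phi> \<in> test_functions"
  shows "(\<lambda>k. norm (c k * integral (cbox 0 1) (\<lambda>x. expo k x * \<phi> x))) summable_on UNIV"
  by (rule Infinite_Sum.abs_summable_on_comparison_test'
      [OF summable_on_cmult_right[OF summable_on_japanese] trig_series_term_bound[OF assms]])

text \<open>Absolute convergence makes the termwise pairing additive, and summing the termwise bound
  gives continuity with respect to one \<open>Ck_norm\<close>.\<close>

lemma trig_series_distribution:
  fixes c :: "int^'n \<Rightarrow> complex"
  assumes c: "\<And>k. norm (c k) \<le> C * japanese k ^ N"
  shows "trig_series c \<in> distributions"
  unfolding distributions_def
proof (intro CollectI conjI ballI allI impI)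
  show "trig_series c \<phi> = 0" if "\<phi> \<notin> test_functions" for \<phi>
    using that by (simp add: trig_series_def)
next
  fix \<phi> \<psi> :: "real^'n \<Rightarrow> complex"
  assume \<phi>: "\<phi> \<in> test_functions" and \<psi>: "\<psi> \<in> test_functions"
  have "integral (cbox 0 1) (\<lambda>x. expo k x * (\<phi> x + \<psi> x)) =
      integral (cbox 0 1) (\<lambda>x. expo k x * \<phi> x) + integral (cbox 0 1) (\<lambda>x. expo k x * \<psi> x)" for k
    unfolding distrib_left
    by (intro integral_add integrable_continuous continuous_intros test_functions_continuous
        expo_test_function \<phi> \<psi>)
  then show "trig_series c (\<lambda>x. \<phi> x + \<psi> x) = trig_series c \<phi> + trig_series c \<psi>"
    using infsum_add[OF abs_summable_summable[OF trig_series_abs_summable[OF c \<phi>]]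
        abs_summable_summable[OF trig_series_abs_summable[OF c \<psi>]]]
    by (simp add: trig_series_def test_functions_add \<phi> \<psi> distrib_left)
next
  fix a and \<phi> :: "real^'n \<Rightarrow> complex"
  assume \<phi>: "\<phi> \<in> test_functions"
  have "c k * integral (cbox 0 1) (\<lambda>x. expo k x * (a * \<phi> x)) =
      a * (c k * integral (cbox 0 1) (\<lambda>x. expo k x * \<phi> x))" for k
  proof -
    have "(\<lambda>x. expo k x * (a * \<phi> x)) = (\<lambda>x. a * (expo k x * \<phi> x))"
      by (simp add: mult_ac)
    then show ?thesis by simp
  qed
  then show "trig_series c (\<lambda>x. a * \<phi> x) = a * trig_series c \<phi>"
    by (simp only: trig_series_def test_functions_cmult \<phi> if_True infsum_cmult_right')
next
  let ?M = "N + 2 * CARD('n)"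
  let ?S = "\<Sum>\<^sub>\<infinity>k::int^'n. 1 / japanese k ^ (2 * CARD('n))"
  show "\<exists>C N. \<forall>\<phi>\<in>test_functions. norm (trig_series c \<phi>) \<le> C * Ck_norm N \<phi>"
  proof (intro exI ballI)
    fix \<phi> :: "real^'n \<Rightarrow> complex"
    assume \<phi>: "\<phi> \<in> test_functions"
    let ?B = "C * sqrt (1 + real CARD('n)) ^ ?M * Ck_norm ?M \<phi>"
    have "norm (trig_series c \<phi>) \<le> (\<Sum>\<^sub>\<infinity>k. norm (c k * integral (cbox 0 1) (\<lambda>x. expo k x * \<phi> x)))"
      using \<phi> trig_series_abs_summable[OF c \<phi>] by (simp add: trig_series_def norm_infsum_bound)
    also have "\<dots> \<le> (\<Sum>\<^sub>\<infinity>k::int^'n. ?B * (1 / japanese k ^ (2 * CARD('n))))"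
      by (intro infsum_mono trig_series_abs_summable[OF c \<phi>] summable_on_cmult_right
          summable_on_japanese trig_series_term_bound[OF c \<phi>])
    also have "\<dots> = ?B * ?S"
      by (rule infsum_cmult_right')
    finally show "norm (trig_series c \<phi>) \<le> C * sqrt (1 + real CARD('n)) ^ ?M * ?S * Ck_norm ?M \<phi>"
      by (simp add: mult_ac)
  qed
qed

text \<open>Pairing with an exponential leaves a single nonzero term by orthogonality, so the
  identity holds for arbitrary coefficients \<open>c\<close>.\<close>

lemma fourier_coeff_trig_series: "fourier_coeff (trig_series c) k = c k"
proof -
  have "integral (cbox 0 1) (\<lambda>x. expo j x * expo (- k) x) = (if j = k then 1 else 0)" for j
    by (simp add: expo_mult integral_expo)
  then have "fourier_coeff (trig_series c) k = (\<Sum>\<^sub>\<infinity>j. c j * (if j = k then 1 else 0))"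
    by (simp add: fourier_coeff_def trig_series_def expo_test_function)
  also have "\<dots> = (\<Sum>\<^sub>\<infinity>j\<in>{k}. c j)"
    by (rule infsum_cong_neutral) auto
  finally show ?thesis by simp
qed

lemma fourier_coeff_multiplier:
  "fourier_coeff (fourier_multiplier \<omega> u) k = of_real (\<omega> k) * fourier_coeff u k"
  by (simp add: fourier_multiplier_def fourier_coeff_trig_series)

lemma distributions_diff:
  assumes u: "u \<in> distributions" and v: "v \<in> distributions"
  shows "u - v \<in> distributions"
proof -
  obtain C N where C: "\<And>\<phi>. \<phi> \<in> test_functions \<Longrightarrow> norm (u \<phi>) \<le> C * Ck_norm N \<phi>"
    using u unfolding distributions_def by blast
  obtain D M where D: "\<And>\<phi>. \<phi> \<in> test_functions \<Longrightarrow> norm (v \<phi>) \<le> D * Ck_norm M \<phi>"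
    using v unfolding distributions_def by blast
  \<comment> \<open>The two orders are combined by taking the larger one; absolute values make the
    constants nonnegative for the monotonicity steps.\<close>
  have "norm ((u - v) \<phi>) \<le> (\<bar>C\<bar> + \<bar>D\<bar>) * Ck_norm (max M N) \<phi>" if \<phi>: "\<phi> \<in> test_functions" for \<phi>
  proof -
    have "norm ((u - v) \<phi>) \<le> norm (u \<phi>) + norm (v \<phi>)"
      by (simp add: norm_triangle_ineq4)
    also have "\<dots> \<le> \<bar>C\<bar> * Ck_norm N \<phi> + \<bar>D\<bar> * Ck_norm M \<phi>"
      by (intro add_mono order_trans[OF C] order_trans[OF D] mult_right_mono Ck_norm_nonneg \<phi>) auto
    also have "\<dots> \<le> \<bar>C\<bar> * Ck_norm (max M N) \<phi> + \<bar>D\<bar> * Ck_norm (max M N) \<phi>"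
      by (intro add_mono mult_left_mono Ck_norm_mono \<phi>) auto
    finally show ?thesis by (simp add: distrib_right)
  qed
  then have "\<exists>C N. \<forall>\<phi>\<in>test_functions. norm ((u - v) \<phi>) \<le> C * Ck_norm N \<phi>"
    by blast
  with u v show ?thesis
    unfolding distributions_def by (simp add: algebra_simps)
qed

lemma fourier_coeff_diff: "fourier_coeff (u - v) k = fourier_coeff u k - fourier_coeff v k"
  by (simp add: fourier_coeff_def)

lemma fourier_coeff_add: "fourier_coeff (u + v) k = fourier_coeff u k + fourier_coeff v k"
  by (simp add: fourier_coeff_def)

section \<open>The Radon transform on exponentials\<close>

lemma expo_sum: "expo k (\<Sum>i\<in>I. f i) = (\<Prod>i\<in>I. expo k (f i))"
  by (induction I rule: infinite_finite_induct) (simp_all add: expo_add, simp_all add: expo_def)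

text \<open>Along the segment the exponential is \<open>exp (c * t)\<close> with \<open>c\<close>
  equal to 2 pi i times an integer \<open>m\<close>. The antiderivative is \<open>t\<close> if
  \<open>m = 0\<close>; otherwise it is \<open>exp (c * t) / c\<close>, which takes the same value
  at both ends.\<close>

lemma has_bochner_integral_expo_segment:
  "has_bochner_integral (restrict_space lborel {0..1}) (\<lambda>t. expo k (t *\<^sub>R vec_of_int v))
    (if (\<Sum>i\<in>UNIV. k $ i * v $ i) = 0 then 1 else 0)"
proof -
  define m where "m = (\<Sum>i\<in>UNIV. k $ i * v $ i)"
  define c where "c = 2 * of_real pi * \<i> * (of_int m :: complex)"
  define F where "F t = (if m = 0 then of_real t else exp (c * of_real t) / c)" for t :: real
  have expo: "expo k (t *\<^sub>R vec_of_int v) = exp (c * of_real t)" for t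
    unfolding expo_def inner_scaleR_right vec_of_int_inner m_def[symmetric] c_def by (simp add: mult_ac)
  have c0: "c = 0 \<longleftrightarrow> m = 0"
    by (simp add: c_def)
  have "has_bochner_integral lborel (\<lambda>t. indicator {0..1} t *\<^sub>R exp (c * of_real t)) (F 1 - F 0)"
  proof (rule has_bochner_integral_FTC_Icc)
    fix t :: real
    have "((\<lambda>z. exp (c * z) / c) has_field_derivative exp (c * of_real t)) (at (of_real t))" if "c \<noteq> 0"
      using that by (auto intro!: derivative_eq_intros)
    then have "((\<lambda>t. exp (c * of_real t) / c) has_vector_derivative exp (c * of_real t)) (at t within {0..1})"
      if "c \<noteq> 0"
      using that by (intro has_vector_derivative_real_field) 
    moreover have "((\<lambda>t. of_real t :: complex) has_vector_derivative 1) (at t within {0..1})"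
      using has_vector_derivative_of_real[OF DERIV_ident] by auto
    ultimately show "(F has_vector_derivative exp (c * of_real t)) (at t within {0..1})"
      unfolding F_def[abs_def] using c0 by (cases "m = 0") auto
  qed (auto intro!: continuous_intros)
  moreover have "exp c = 1"
    unfolding c_def using exp_2pi_1_int[of m] by (simp add: mult_ac)
  then have "F 1 - F 0 = (if m = 0 then 1 else 0)"
    by (simp add: F_def)
  ultimately show ?thesis
    by (simp add: has_bochner_integral_restrict_space expo m_def)
qed

text \<open>Exponentials turn sums into products, so by Fubini the integral over the unit cube
  factors into one segment integral, 0 or 1, per direction.\<close>

lemma radon_fun_expo:
  "radon_fun vs (expo k) x =
    (if \<forall>v\<in>set vs. (\<Sum>i\<in>UNIV. k $ i * v $ i) = 0 then expo k x else 0)"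
proof -
  let ?M = "\<lambda>i::nat. restrict_space lborel {0..1::real}"
  let ?f = "\<lambda>i t. expo k (t *\<^sub>R vec_of_int (vs ! i))"
  interpret product_sigma_finite ?M
    by (simp add: product_sigma_finite_def sigma_finite_measure_restrict_space
        lborel.sigma_finite_measure_axioms)
  have "radon_fun vs (expo k) x = expo k x * (\<integral>t. (\<Prod>i<length vs. ?f i (t i)) \<partial>(\<Pi>\<^sub>M i\<in>{..<length vs}. ?M i))"
    by (simp add: radon_fun_def expo_add expo_sum)
  also have "(\<integral>t. (\<Prod>i<length vs. ?f i (t i)) \<partial>(\<Pi>\<^sub>M i\<in>{..<length vs}. ?M i))
      = (\<Prod>i<length vs. \<integral>t. ?f i t \<partial>?M i)"
    by (rule product_integral_prod) (use has_bochner_integral_expo_segment in \<open>auto simp: has_bochner_integral_iff\<close>)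
  also have "\<dots> = (\<Prod>i<length vs. if (\<Sum>j\<in>UNIV. k $ j * (vs ! i) $ j) = 0 then 1 else 0)"
    by (simp add: has_bochner_integral_integral_eq[OF has_bochner_integral_expo_segment])
  also have "\<dots> = (if \<forall>v\<in>set vs. (\<Sum>i\<in>UNIV. k $ i * v $ i) = 0 then 1 else 0)"
    by (auto simp: all_set_conv_all_nth)
  finally show ?thesis by simp
qed

section \<open>Rational subspaces: integer bases and orthogonality\<close>

text \<open>Clearing denominators shows that the integer points of \<open>A\<close> span
  \<open>A\<close>; a maximal independent subset of them is the basis. It guarantees that the choice
  in \<open>radon\<close> picks a genuine basis.\<close>

lemma integer_basis_exists:
  fixes A :: "(rat^'n) set"
  assumes "vec.subspace A"
  shows "\<exists>vs. integer_basis A vs"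
proof -
  define S where "S = A \<inter> range vec_rat_of_int"
  obtain B where B: "B \<subseteq> S" "vec.independent B" "S \<subseteq> vec.span B"
    using vec.maximal_independent_subset by blast
  have "A \<subseteq> vec.span S"
  proof
    fix a assume a: "a \<in> A"
    define N where "N = (\<Prod>i\<in>UNIV. snd (quotient_of (a $ i)))"
    have N: "N \<noteq> 0"
      using quotient_of_denom_pos' by (simp add: N_def) (metis less_irrefl)
    have "\<exists>m. of_int N * a $ i = of_int m" for i
    proof -
      have "snd (quotient_of (a $ i)) dvd N"
        unfolding N_def by (intro dvd_prodI) auto
      then obtain q where "N = snd (quotient_of (a $ i)) * q" by blast
      moreover have "a $ i = of_int (fst (quotient_of (a $ i))) / of_int (snd (quotient_of (a $ i)))"
        by (rule quotient_of_div) simp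
      moreover have "snd (quotient_of (a $ i)) \<noteq> 0"
        using quotient_of_denom_pos'[of "a $ i"] by linarith
      ultimately have "of_int N * a $ i = of_int (q * fst (quotient_of (a $ i)))"
        by (simp add: field_simps)
      then show ?thesis by blast
    qed
    then obtain m where m: "\<And>i. of_int N * a $ i = of_int (m i)" by metis
    have "of_int N *s a = vec_rat_of_int (\<chi> i. m i)"
      by (simp add: vec_eq_iff vec_rat_of_int_def m)
    then have "of_int N *s a \<in> S"
      using vec.subspace_scale[OF assms a, of "of_int N"] unfolding S_def by (metis IntI rangeI)
    then have "(1 / of_int N) *s (of_int N *s a) \<in> vec.span S"
      by (intro vec.span_scale vec.span_base)
    with N show "a \<in> vec.span S" by simp
  qed
  moreover have "vec.span S \<subseteq> vec.span B"
    using B(3) by (simp add: vec.span_minimal)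
  moreover have "vec.span B \<subseteq> A"
    using B(1) assms by (intro vec.span_minimal) (auto simp: S_def)
  ultimately have span: "vec.span B = A" by blast
  have inj: "inj (vec_rat_of_int :: int^'n \<Rightarrow> rat^'n)"
    by (simp add: inj_on_def vec_rat_of_int_def vec_eq_iff)
  have "B \<subseteq> range vec_rat_of_int"
    using B(1) by (simp add: S_def)
  then obtain B' where B': "B = vec_rat_of_int ` B'"
    by (auto simp: subset_image_iff)
  then have "finite B'"
    using vec.finiteI_independent[OF B(2)] inj by (meson finite_imageD inj_on_subset subset_UNIV)
  then obtain vs where "distinct vs" "set vs = B'"
    using finite_distinct_list by blast
  with B' B(2) span show ?thesis
    unfolding integer_basis_def by blast
qed

text \<open>The vectors orthogonal to \<open>k\<close> form a subspace, so testing generators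
  suffices. For integer generators the rational sum is the image of an integer sum, the form in
  which the Radon integral yields the condition.\<close>

lemma orthogonal_to_span:
  "orthogonal_to k (vec.span (vec_rat_of_int ` V)) \<longleftrightarrow> (\<forall>v\<in>V. (\<Sum>i\<in>UNIV. k $ i * v $ i) = 0)"
proof -
  have eq: "(\<Sum>i\<in>UNIV. of_int (k $ i) * vec_rat_of_int v $ i) =
      (of_int (\<Sum>i\<in>UNIV. k $ i * v $ i) :: rat)" for v
    by (simp add: vec_rat_of_int_def)
  have sub: "vec.subspace {v :: rat^'a. (\<Sum>i\<in>UNIV. of_int (k $ i) * v $ i) = 0}"
  proof (rule vec.subspaceI)
    fix c :: rat and v :: "rat^'a"
    have "(\<Sum>i\<in>UNIV. of_int (k $ i) * (c *s v) $ i) = c * (\<Sum>i\<in>UNIV. of_int (k $ i) * v $ i)"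
      by (simp add: sum_distrib_left mult_ac)
    then show "v \<in> {v. (\<Sum>i\<in>UNIV. of_int (k $ i) * v $ i) = 0} \<Longrightarrow>
        c *s v \<in> {v. (\<Sum>i\<in>UNIV. of_int (k $ i) * v $ i) = 0}"
      by simp
  qed (simp_all add: distrib_left sum.distrib)
  show ?thesis
  proof
    assume "orthogonal_to k (vec.span (vec_rat_of_int ` V))"
    then have "(\<Sum>i\<in>UNIV. of_int (k $ i) * vec_rat_of_int v $ i) = (0 :: rat)" if "v \<in> V" for v
      using that by (simp add: orthogonal_to_def vec.span_base)
    then show "\<forall>v\<in>V. (\<Sum>i\<in>UNIV. k $ i * v $ i) = 0"
      unfolding eq of_int_eq_0_iff by blast
  next
    assume "\<forall>v\<in>V. (\<Sum>i\<in>UNIV. k $ i * v $ i) = 0"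
    then have "vec_rat_of_int ` V \<subseteq> {v. (\<Sum>i\<in>UNIV. of_int (k $ i) * v $ i) = 0}"
      by (auto simp: eq)
    from vec.span_minimal[OF this sub]
    show "orthogonal_to k (vec.span (vec_rat_of_int ` V))"
      by (auto simp: orthogonal_to_def)
  qed
qed

text \<open>By duality the coefficient is \<open>u\<close> applied to the transform of
  \<open>expo (- k)\<close>, which is either \<open>expo (- k)\<close> or 0. The chosen basis enters
  only through its span, and orthogonality is insensitive to the sign of \<open>k\<close>.\<close>

lemma fourier_coeff_radon:
  assumes u: "u \<in> distributions" and A: "vec.subspace A"
  shows "fourier_coeff (radon u A) k = (if orthogonal_to k A then fourier_coeff u k else 0)"
proof -
  define vs where "vs = (SOME vs. integer_basis A vs)"
  have "integer_basis A vs"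
    unfolding vs_def using integer_basis_exists[OF A] by (rule someI_ex)
  then have "orthogonal_to k A \<longleftrightarrow> (\<forall>v\<in>set vs. (\<Sum>i\<in>UNIV. k $ i * v $ i) = 0)"
    unfolding integer_basis_def using orthogonal_to_span by metis
  moreover have "u (\<lambda>_. 0) = 0"
  proof -
    have "u (\<lambda>x. 0 * expo 0 x) = 0 * u (expo 0)"
      using u expo_test_function unfolding distributions_def by blast
    then show ?thesis by simp
  qed
  moreover have "radon_fun vs (expo (- k)) =
      (if \<forall>v\<in>set vs. (\<Sum>i\<in>UNIV. k $ i * v $ i) = 0 then expo (- k) else (\<lambda>_. 0))"
    by (auto simp: fun_eq_iff radon_fun_expo sum_negf)
  ultimately show ?thesis
    by (auto simp: fourier_coeff_def radon_def vs_def[symmetric] radon_dist_def)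
qed

section \<open>Square-summable families\<close>

text \<open>Minkowski on finite subsets, passed to the limit. Only domination of \<open>c\<close> is
  assumed, so the same lemma yields Sobolev membership and norm estimates.\<close>

lemma infsum_l2_triangle:
  fixes a b c :: "'a \<Rightarrow> real"
  assumes le: "\<And>x. x \<in> A \<Longrightarrow> 0 \<le> c x \<and> c x \<le> a x + b x"
    and a: "(\<lambda>x. (a x)\<^sup>2) summable_on A" and b: "(\<lambda>x. (b x)\<^sup>2) summable_on A"
  shows "(\<lambda>x. (c x)\<^sup>2) summable_on A"
    and "sqrt (\<Sum>\<^sub>\<infinity>x\<in>A. (c x)\<^sup>2) \<le> sqrt (\<Sum>\<^sub>\<infinity>x\<in>A. (a x)\<^sup>2) + sqrt (\<Sum>\<^sub>\<infinity>x\<in>A. (b x)\<^sup>2)"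
proof -
  let ?R = "sqrt (\<Sum>\<^sub>\<infinity>x\<in>A. (a x)\<^sup>2) + sqrt (\<Sum>\<^sub>\<infinity>x\<in>A. (b x)\<^sup>2)"
  have R: "0 \<le> ?R"
    by (simp add: infsum_nonneg)
  have bound: "(\<Sum>x\<in>F. (c x)\<^sup>2) \<le> ?R\<^sup>2" if F: "finite F" "F \<subseteq> A" for F
  proof -
    have "L2_set c F \<le> L2_set (\<lambda>x. a x + b x) F"
      using le F by (intro L2_set_mono) auto
    also have "\<dots> \<le> L2_set a F + L2_set b F"
      by (rule L2_set_triangle_ineq)
    also have "\<dots> \<le> ?R"
      unfolding L2_set_def using F a b
      by (intro add_mono real_sqrt_le_mono finite_sum_le_infsum) auto
    finally have "sqrt (\<Sum>x\<in>F. (c x)\<^sup>2) \<le> ?R"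
      by (simp add: L2_set_def)
    then show ?thesis
      by (rule sqrt_le_D)
  qed
  show c: "(\<lambda>x. (c x)\<^sup>2) summable_on A"
    using bound by (intro nonneg_bdd_above_summable_on bdd_aboveI2[where M = "?R\<^sup>2"]) auto
  have "(\<Sum>\<^sub>\<infinity>x\<in>A. (c x)\<^sup>2) \<le> ?R\<^sup>2"
    using c bound by (rule infsum_le_finite_sums)
  with R show "sqrt (\<Sum>\<^sub>\<infinity>x\<in>A. (c x)\<^sup>2) \<le> ?R"
    by (rule real_le_lsqrt)
qed

lemma infsum_Cauchy_Schwarz:
  fixes a b :: "'a \<Rightarrow> real"
  assumes a: "(\<lambda>x. (a x)\<^sup>2) summable_on A" and b: "(\<lambda>x. (b x)\<^sup>2) summable_on A"
  shows "(\<lambda>x. \<bar>a x\<bar> * \<bar>b x\<bar>) summable_on A"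
    and "(\<Sum>\<^sub>\<infinity>x\<in>A. \<bar>a x\<bar> * \<bar>b x\<bar>) \<le> sqrt (\<Sum>\<^sub>\<infinity>x\<in>A. (a x)\<^sup>2) * sqrt (\<Sum>\<^sub>\<infinity>x\<in>A. (b x)\<^sup>2)"
proof -
  let ?R = "sqrt (\<Sum>\<^sub>\<infinity>x\<in>A. (a x)\<^sup>2) * sqrt (\<Sum>\<^sub>\<infinity>x\<in>A. (b x)\<^sup>2)"
  have bound: "(\<Sum>x\<in>F. \<bar>a x\<bar> * \<bar>b x\<bar>) \<le> ?R" if F: "finite F" "F \<subseteq> A" for F
  proof -
    have "(\<Sum>x\<in>F. \<bar>a x\<bar> * \<bar>b x\<bar>) \<le> L2_set a F * L2_set b F"
      by (rule L2_set_mult_ineq)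
    also have "\<dots> \<le> ?R"
      unfolding L2_set_def using F a b
      by (intro mult_mono real_sqrt_le_mono finite_sum_le_infsum) (auto intro: sum_nonneg infsum_nonneg)
    finally show ?thesis .
  qed
  show ab: "(\<lambda>x. \<bar>a x\<bar> * \<bar>b x\<bar>) summable_on A"
    using bound by (intro nonneg_bdd_above_summable_on bdd_aboveI2[where M = ?R]) auto
  show "(\<Sum>\<^sub>\<infinity>x\<in>A. \<bar>a x\<bar> * \<bar>b x\<bar>) \<le> ?R"
    using ab bound by (rule infsum_le_finite_sums)
qed

text \<open>Dominated convergence along an arbitrary filter: a finite set \<open>S\<close> carries
  all but e/2 of the majorant, the finite sum over \<open>S\<close> tends to 0, and the rest is
  bounded by the tail of \<open>M\<close>.\<close>

lemma tendsto_infsum_dominated: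
  fixes u :: "'b \<Rightarrow> 'a \<Rightarrow> real"
  assumes M: "M summable_on A"
    and dom: "\<forall>\<^sub>F x in F. \<forall>k\<in>A. 0 \<le> u x k \<and> u x k \<le> M k"
    and lim: "\<And>k. k \<in> A \<Longrightarrow> ((\<lambda>x. u x k) \<longlongrightarrow> 0) F"
  shows "((\<lambda>x. \<Sum>\<^sub>\<infinity>k\<in>A. u x k) \<longlongrightarrow> 0) F"
proof (rule tendstoI)
  fix e :: real assume e: "e > 0"
  then obtain S where S: "finite S" "S \<subseteq> A" and "dist (sum M S) (infsum M A) \<le> e / 2"
    using infsum_finite_approximation[OF M, of "e / 2"] by auto
  then have tail: "infsum M A - sum M S \<le> e / 2"
    unfolding dist_real_def by linarith
  have "((\<lambda>x. \<Sum>k\<in>S. u x k) \<longlongrightarrow> (\<Sum>k\<in>S. 0)) F"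
    using S lim by (intro tendsto_sum) auto
  then have "\<forall>\<^sub>F x in F. (\<Sum>k\<in>S. u x k) < e / 2"
    using e by (intro order_tendstoD) auto
  with dom show "\<forall>\<^sub>F x in F. dist (\<Sum>\<^sub>\<infinity>k\<in>A. u x k) 0 < e"
  proof eventually_elim
    case (elim x)
    then have u: "u x summable_on A"
      by (intro summable_on_comparison_test[OF M]) auto
    have "infsum (u x) (A - S) \<le> infsum M (A - S)"
      using elim by (intro infsum_mono summable_on_subset[OF u] summable_on_subset[OF M]) auto
    moreover have "infsum M (A - S) = infsum M A - sum M S" "infsum (u x) (A - S) = infsum (u x) A - sum (u x) S"
      using S M u by (simp_all add: infsum_Diff)
    ultimately have "infsum (u x) A < e"
      using elim tail by linarith
    moreover have "infsum (u x) A \<ge> 0"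
      using elim by (intro infsum_nonneg) auto
    ultimately show ?case by simp
  qed
qed

section \<open>Sobolev and data spaces\<close>

text \<open>Puts the summand into the shape of a square, so that the l2 lemmas apply.\<close>

lemma sobolev_term:
  "japanese k powr (2 * s) * (norm z)\<^sup>2 = (japanese k powr s * norm z)\<^sup>2"
  by (simp add: power_mult_distrib power2_eq_square flip: powr_add)

lemma sobolev_summable:
  "u \<in> sobolev s \<Longrightarrow> (\<lambda>k. (japanese k powr s * norm (fourier_coeff u k))\<^sup>2) summable_on UNIV"
  by (simp add: sobolev_def sobolev_term)

lemma sobolev_norm_eq:
  "sobolev_norm s u = sqrt (\<Sum>\<^sub>\<infinity>k. (japanese k powr s * norm (fourier_coeff u k))\<^sup>2)"
  by (simp add: sobolev_norm_def sobolev_term)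

text \<open>Each weighted coefficient is at most the l2 norm of the whole family, so the
  coefficients grow at most polynomially and the series is a distribution.\<close>

lemma trig_series_sobolev:
  fixes c :: "int^'n \<Rightarrow> complex"
  assumes sum: "(\<lambda>k. (japanese k powr s * norm (c k))\<^sup>2) summable_on UNIV"
  shows "trig_series c \<in> sobolev s"
proof -
  let ?S = "\<Sum>\<^sub>\<infinity>k. (japanese k powr s * norm (c k))\<^sup>2"
  have "norm (c k) \<le> sqrt ?S * japanese k ^ nat \<lceil>\<bar>s\<bar>\<rceil>" for k
  proof -
    have "(japanese k powr s * norm (c k))\<^sup>2 \<le> ?S"
      using finite_sum_le_infsum[OF sum, of "{k}"] by simp
    then have "japanese k powr s * norm (c k) \<le> sqrt ?S"
      by (rule real_le_rsqrt)
    then have "norm (c k) \<le> sqrt ?S * japanese k powr (- s)"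
      by (simp add: powr_minus field_simps)
    also have "\<dots> \<le> sqrt ?S * japanese k powr (real (nat \<lceil>\<bar>s\<bar>\<rceil>))"
      using japanese_ge_1[of k] by (intro mult_left_mono powr_mono real_sqrt_ge_zero infsum_nonneg) (auto, linarith)
    finally show ?thesis
      by (simp only: powr_realpow japanese_pos)
  qed
  then have "trig_series c \<in> distributions"
    by (rule trig_series_distribution)
  with sum show ?thesis
    by (simp add: sobolev_def sobolev_term fourier_coeff_trig_series)
qed

lemma sobolev_diff:
  assumes u: "u \<in> sobolev s" and v: "v \<in> sobolev s"
  shows "u - v \<in> sobolev s"
proof -
  have "(\<lambda>k. (japanese k powr s * norm (fourier_coeff (u - v) k))\<^sup>2) summable_on UNIV"
    by (rule infsum_l2_triangle(1)[OF _ sobolev_summable[OF u] sobolev_summable[OF v]])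
      (auto simp: fourier_coeff_diff norm_triangle_ineq4 simp flip: distrib_left intro!: mult_left_mono)
  then show ?thesis
    using u v by (simp add: sobolev_def sobolev_term distributions_diff)
qed

lemma sobolev_antimono:
  assumes "u \<in> sobolev s" and "r \<le> s"
  shows "u \<in> sobolev r"
proof -
  have "(\<lambda>k. (japanese k powr r * norm (fourier_coeff u k))\<^sup>2) summable_on UNIV"
    using japanese_ge_1 assms(2)
    by (intro summable_on_comparison_test[OF sobolev_summable[OF assms(1)]] power_mono mult_right_mono powr_mono) auto
  then show ?thesis
    using assms(1) by (simp add: sobolev_def sobolev_term)
qed

lemma sobolev_norm_multiplier:
  "(sobolev_norm t (fourier_multiplier \<omega> u))\<^sup>2
    = (\<Sum>\<^sub>\<infinity>k. japanese k powr (2 * t) * ((\<omega> k)\<^sup>2 * (norm (fourier_coeff u k))\<^sup>2))"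
  unfolding sobolev_norm_def
  by (subst real_sqrt_pow2) (auto simp: fourier_coeff_multiplier norm_mult power_mult_distrib intro!: infsum_nonneg)

lemma data_norm_nonneg: "data_norm d t w g \<ge> 0"
  by (simp add: data_norm_def infsum_nonneg)

text \<open>Interchanging the sums over \<open>A\<close> and \<open>k\<close> expresses the data
  norm frequency by frequency. The last bound is an inequality because \<open>E k\<close> sees only
  the subspaces orthogonal to \<open>k\<close>, while the data norm sums over the whole
  Grassmannian.\<close>

lemma data_space_fourier:
  assumes g: "g \<in> data_space d t w"
  defines "E \<equiv> \<lambda>k. \<Sum>\<^sub>\<infinity>A\<in>Omega d k. (w k A)\<^sup>2 * (norm (fourier_coeff (g A) k))\<^sup>2"
  shows "(\<lambda>A. (w k A)\<^sup>2 * (norm (fourier_coeff (g A) k))\<^sup>2) summable_on Omega d k"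
    and "(\<lambda>k. japanese k powr (2 * t) * E k) summable_on UNIV"
    and "(\<Sum>\<^sub>\<infinity>k. japanese k powr (2 * t) * E k) \<le> (data_norm d t w g)\<^sup>2"
proof -
  let ?Gr = "grassmannian d"
  define a where "a k A = (w k A)\<^sup>2 * (norm (fourier_coeff (g A) k))\<^sup>2" for k A
  define G where "G A k = japanese k powr (2 * t) * a k A" for k A
  have nonneg: "a k A \<ge> 0" "G A k \<ge> 0" for A k
    by (simp_all add: a_def G_def)
  have inner: "(G A) summable_on UNIV" if "A \<in> ?Gr" for A
    using g that by (auto simp: data_space_def sobolev_def fourier_coeff_multiplier norm_mult
        power_mult_distrib G_def[abs_def] a_def[abs_def])
  have eq: "(sobolev_norm t (fourier_multiplier (\<lambda>k. w k A) (g A)))\<^sup>2 = (\<Sum>\<^sub>\<infinity>k. G A k)" for A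
    by (simp add: sobolev_norm_multiplier G_def a_def)
  have outer: "(\<lambda>A. \<Sum>\<^sub>\<infinity>k. G A k) summable_on ?Gr"
    using g by (simp add: data_space_def eq)
  have norm: "(data_norm d t w g)\<^sup>2 = (\<Sum>\<^sub>\<infinity>A\<in>?Gr. \<Sum>\<^sub>\<infinity>k. G A k)"
    by (simp add: data_norm_def eq infsum_nonneg nonneg)
  \<comment> \<open>All terms are nonnegative, so summability of the iterated sum gives joint
    summability, which permits the interchange.\<close>
  have joint: "(\<lambda>(A, k). G A k) summable_on (?Gr \<times> UNIV)"
    using inner nonneg by (intro summable_on_SigmaI[OF _ outer]) auto
  then have joint': "(\<lambda>(k, A). G A k) summable_on (UNIV \<times> ?Gr)"
    using summable_on_swap[of "\<lambda>(A, k). G A k" ?Gr UNIV] by simp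
  have sub: "Omega d k \<subseteq> ?Gr" for k
    by (auto simp: Omega_def)
  have G_k: "(\<lambda>A. G A k) summable_on ?Gr" for k
    using joint' by (rule summable_on_SigmaD1) simp
  have a_k: "a k summable_on ?Gr" for k
  proof -
    have "(\<lambda>A. japanese k powr (- (2 * t)) * G A k) summable_on ?Gr"
      by (intro summable_on_cmult_right G_k)
    then show ?thesis
      by (simp add: G_def powr_minus flip: mult.assoc)
  qed
  then have a_Omega: "a k summable_on Omega d k" for k
    using sub summable_on_subset by blast
  then show "(\<lambda>A. (w k A)\<^sup>2 * (norm (fourier_coeff (g A) k))\<^sup>2) summable_on Omega d k"
    by (simp add: a_def[abs_def])
  have E: "E k = (\<Sum>\<^sub>\<infinity>A\<in>Omega d k. a k A)" for k
    by (simp add: E_def a_def)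
  have le: "japanese k powr (2 * t) * E k \<le> (\<Sum>\<^sub>\<infinity>A\<in>?Gr. G A k)" for k
  proof -
    have "E k \<le> (\<Sum>\<^sub>\<infinity>A\<in>?Gr. a k A)"
      unfolding E using a_k a_Omega sub nonneg by (intro infsum_mono2) auto
    then have "japanese k powr (2 * t) * E k \<le> japanese k powr (2 * t) * (\<Sum>\<^sub>\<infinity>A\<in>?Gr. a k A)"
      by (intro mult_left_mono) auto
    then show ?thesis
      by (simp add: G_def infsum_cmult_right')
  qed
  have sum: "(\<lambda>k. \<Sum>\<^sub>\<infinity>A\<in>?Gr. G A k) summable_on UNIV"
    using joint' by (rule summable_on_Sigma_banach)
  show sE: "(\<lambda>k. japanese k powr (2 * t) * E k) summable_on UNIV"
    using le nonneg by (intro summable_on_comparison_test[OF sum]) (auto simp: E infsum_nonneg)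
  have "(\<Sum>\<^sub>\<infinity>k. japanese k powr (2 * t) * E k) \<le> (\<Sum>\<^sub>\<infinity>k. \<Sum>\<^sub>\<infinity>A\<in>?Gr. G A k)"
    using sE sum le by (intro infsum_mono) auto
  also have "\<dots> = (data_norm d t w g)\<^sup>2"
    unfolding norm by (rule infsum_swap_banach[OF joint'])
  finally show "(\<Sum>\<^sub>\<infinity>k. japanese k powr (2 * t) * E k) \<le> (data_norm d t w g)\<^sup>2" .
qed

text \<open>Zero data will serve as the competitor that bounds the supremum over all admissible
  noise from below.\<close>

lemma
  fixes w :: "('n::finite) weight_fun"
  shows zero_in_data_space: "(\<lambda>A \<phi>. 0) \<in> data_space d t w"
    and data_norm_zero: "data_norm d t w (\<lambda>A \<phi>. 0) = 0"
proof -
  have "trig_series (\<lambda>_. 0) = (\<lambda>\<phi>. 0)"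
    by (auto simp: trig_series_def)
  then have "fourier_multiplier \<omega> (\<lambda>\<phi>. 0) = (\<lambda>\<phi>. 0)" for \<omega> :: "int^'n \<Rightarrow> real"
    by (simp add: fourier_multiplier_def fourier_coeff_def)
  moreover have "(\<lambda>\<phi>. 0) \<in> (distributions :: 'n functional set)"
    by (auto simp: distributions_def intro: exI[of _ 0])
  moreover have "sobolev_norm s (\<lambda>\<phi>::real^'n \<Rightarrow> complex. 0) = 0" for s
    by (simp add: sobolev_norm_def fourier_coeff_def)
  ultimately show "(\<lambda>A \<phi>. 0) \<in> data_space d t w"
      and "data_norm d t w (\<lambda>A \<phi>. 0) = 0"
    by (simp_all add: data_space_def data_norm_def sobolev_def fourier_coeff_def)
qed

section \<open>Tikhonov regularization\<close>

text \<open>The symbol of \<open>I - P R\<^sup>* R\<close>, where \<open>R\<close> is the Radon transform and \<open>P\<close> the multiplier of the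
  regularization.\<close>

definition damping :: "nat \<Rightarrow> ('n::finite) weight_fun \<Rightarrow> real \<Rightarrow> real \<Rightarrow> int^'n \<Rightarrow> real" where
  "damping d w s \<alpha> k = \<alpha> * japanese k powr (2 * s) / (W d w k + \<alpha> * japanese k powr (2 * s))"

text \<open>\<open>C\<close> enters here only through its square; the lemmas that take its root
  assume \<open>C > 0\<close> themselves.\<close>

locale bounded_weight =
  fixes d :: nat and w :: "('n::finite) weight_fun" and c C :: real
  assumes c_pos: "c > 0"
    and W_lower: "c\<^sup>2 \<le> W d w k"
    and W_upper: "W d w k \<le> C\<^sup>2"
begin

lemma W_pos: "W d w k > 0"
  using W_lower[of k] c_pos by (meson less_le_trans zero_less_power)

text \<open>A divergent sum has the value 0 by convention, which positivity of
  \<open>W d w k\<close> excludes.\<close>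

lemma weight_summable: "(\<lambda>A. (w k A)\<^sup>2) summable_on Omega d k"
  using W_pos[of k] infsum_not_exists unfolding W_def by fastforce

lemma denominator_pos:
  assumes "\<alpha> \<ge> 0"
  shows "W d w k + \<alpha> * japanese k powr (2 * s) > 0"
  using assms W_pos[of k] by (intro add_pos_nonneg) auto

lemma damping_nonneg: "\<alpha> \<ge> 0 \<Longrightarrow> damping d w s \<alpha> k \<ge> 0"
  using denominator_pos[of \<alpha> k s] by (simp add: damping_def)

lemma damping_le_1: "\<alpha> \<ge> 0 \<Longrightarrow> damping d w s \<alpha> k \<le> 1"
  using denominator_pos[of \<alpha> k s] W_pos[of k] by (simp add: damping_def)

section \<open>The adjoint, the reconstruction and the noise on the Fourier side\<close>

text \<open>Split the weight \<open>w^2\<close> into \<open>w\<close> times \<open>w\<close> and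
  apply Cauchy-Schwarz: the squares of the first factor sum to \<open>W d w k\<close>, the second
  carries the data.\<close>

lemma radon_adjoint_bound:
  assumes g: "g \<in> data_space d t w"
  shows "(\<lambda>A. of_real ((w k A)\<^sup>2) * fourier_coeff (g A) k) summable_on Omega d k"
    and "norm (fourier_coeff (radon_adjoint d w g) k)
      \<le> sqrt (W d w k) * sqrt (\<Sum>\<^sub>\<infinity>A\<in>Omega d k. (w k A)\<^sup>2 * (norm (fourier_coeff (g A) k))\<^sup>2)"
proof -
  have "(\<lambda>A. (w k A * norm (fourier_coeff (g A) k))\<^sup>2) summable_on Omega d k"
    using data_space_fourier(1)[OF g] by (simp add: power_mult_distrib)
  note CS = infsum_Cauchy_Schwarz[OF weight_summable this]
  have eq: "\<bar>w k A\<bar> * \<bar>w k A * norm (fourier_coeff (g A) k)\<bar>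
      = norm (of_real ((w k A)\<^sup>2) * fourier_coeff (g A) k)" for A
    by (simp add: norm_mult abs_mult power2_eq_square)
  show "(\<lambda>A. of_real ((w k A)\<^sup>2) * fourier_coeff (g A) k) summable_on Omega d k"
    using CS(1) unfolding eq by (rule abs_summable_summable)
  have "norm (fourier_coeff (radon_adjoint d w g) k) \<le> (\<Sum>\<^sub>\<infinity>A\<in>Omega d k. norm (of_real ((w k A)\<^sup>2) * fourier_coeff (g A) k))"
    unfolding radon_adjoint_def fourier_coeff_trig_series using CS(1) unfolding eq by (rule norm_infsum_bound)
  with CS(2) show "norm (fourier_coeff (radon_adjoint d w g) k)
      \<le> sqrt (W d w k) * sqrt (\<Sum>\<^sub>\<infinity>A\<in>Omega d k. (w k A)\<^sup>2 * (norm (fourier_coeff (g A) k))\<^sup>2)"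
    unfolding eq by (simp add: W_def power_mult_distrib)
qed

text \<open>For \<open>A\<close> in \<open>Omega d k\<close> the transform \<open>radon f A\<close>
  retains the coefficient of \<open>f\<close>, so its weights add up to \<open>W d w k\<close>.
  Stating both parts with \<open>has_sum\<close> records the convergence that splitting the sum
  requires.\<close>

lemma fourier_coeff_radon_adjoint:
  assumes f: "f \<in> distributions" and g: "g \<in> data_space d t w"
  shows "fourier_coeff (radon_adjoint d w (radon f + g)) k
    = of_real (W d w k) * fourier_coeff f k + fourier_coeff (radon_adjoint d w g) k"
proof -
  have "((\<lambda>A. (w k A)\<^sup>2) has_sum W d w k) (Omega d k)"
    unfolding W_def using weight_summable by (rule has_sum_infsum)
  then have "((\<lambda>A. of_real ((w k A)\<^sup>2) * fourier_coeff f k) has_sum of_real (W d w k) * fourier_coeff f k) (Omega d k)"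
    by (intro has_sum_cmult_left has_sum_of_real)
  moreover have "((\<lambda>A. of_real ((w k A)\<^sup>2) * fourier_coeff (g A) k) has_sum fourier_coeff (radon_adjoint d w g) k) (Omega d k)"
    unfolding radon_adjoint_def fourier_coeff_trig_series by (intro has_sum_infsum radon_adjoint_bound(1)[OF g])
  ultimately have "((\<lambda>A. of_real ((w k A)\<^sup>2) * fourier_coeff f k + of_real ((w k A)\<^sup>2) * fourier_coeff (g A) k)
      has_sum of_real (W d w k) * fourier_coeff f k + fourier_coeff (radon_adjoint d w g) k) (Omega d k)"
    by (rule has_sum_add)
  then have "((\<lambda>A. of_real ((w k A)\<^sup>2) * fourier_coeff ((radon f + g) A) k)
      has_sum of_real (W d w k) * fourier_coeff f k + fourier_coeff (radon_adjoint d w g) k) (Omega d k)"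
  proof (rule has_sum_cong[THEN iffD1, rotated])
    show "of_real ((w k A)\<^sup>2) * fourier_coeff f k + of_real ((w k A)\<^sup>2) * fourier_coeff (g A) k
        = of_real ((w k A)\<^sup>2) * fourier_coeff ((radon f + g) A) k" if "A \<in> Omega d k" for A
      using that fourier_coeff_radon[OF f, of A k]
      by (simp add: Omega_def grassmannian_def fourier_coeff_add distrib_left)
  qed
  then show ?thesis
    unfolding radon_adjoint_def fourier_coeff_trig_series by (rule infsumI)
qed

lemma fourier_coeff_tikhonov:
  assumes f: "f \<in> distributions" and g: "g \<in> data_space d t w" and \<alpha>: "\<alpha> \<ge> 0"
  shows "fourier_coeff (tikhonov d w s \<alpha> (radon_adjoint d w (radon f + g))) k
    = of_real (1 - damping d w s \<alpha> k) * fourier_coeff f k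
      + fourier_coeff (radon_adjoint d w g) k / of_real (W d w k + \<alpha> * japanese k powr (2 * s))"
proof -
  let ?D = "W d w k + \<alpha> * japanese k powr (2 * s)"
  have "1 - damping d w s \<alpha> k = W d w k / ?D"
    using denominator_pos[OF \<alpha>, of k s] by (simp add: damping_def field_simps)
  then show ?thesis
    unfolding tikhonov_def fourier_coeff_multiplier fourier_coeff_radon_adjoint[OF f g]
    by (simp add: distrib_left)
qed

text \<open>The adjoint costs at most the factor \<open>C\<close>, and the multiplier gains
  \<open>2 * s\<close> derivatives at the price 1 / \<alpha>, which carries order \<open>t\<close>
  of the data to order \<open>r\<close>.\<close>

lemma regularized_noise:
  assumes g: "g \<in> data_space d t w" and \<alpha>: "\<alpha> > 0" and rts: "r \<le> 2 * s + t" and C: "C > 0"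
  defines "b \<equiv> \<lambda>k. japanese k powr r * norm (fourier_coeff (radon_adjoint d w g) k / of_real (W d w k + \<alpha> * japanese k powr (2 * s)))"
  shows "(\<lambda>k. (b k)\<^sup>2) summable_on UNIV"
    and "sqrt (\<Sum>\<^sub>\<infinity>k. (b k)\<^sup>2) \<le> C / \<alpha> * data_norm d t w g"
proof -
  define E where "E k = (\<Sum>\<^sub>\<infinity>A\<in>Omega d k. (w k A)\<^sup>2 * (norm (fourier_coeff (g A) k))\<^sup>2)" for k
  have E: "E k \<ge> 0" for k
    by (simp add: E_def infsum_nonneg)
  have le: "(b k)\<^sup>2 \<le> (C / \<alpha>)\<^sup>2 * (japanese k powr (2 * t) * E k)" for k
  proof -
    let ?J = "japanese k powr (2 * s)" and ?D = "W d w k + \<alpha> * japanese k powr (2 * s)"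
    have D: "?D > 0"
      using \<alpha> by (intro denominator_pos) simp
    have "norm (fourier_coeff (radon_adjoint d w g) k) \<le> C * sqrt (E k)"
    proof -
      have "sqrt (W d w k) \<le> C"
        using W_upper[of k] C by (intro real_le_lsqrt) auto
      then show ?thesis
        using radon_adjoint_bound(2)[OF g, of k] E[of k] unfolding E_def
        by (meson mult_right_mono order_trans real_sqrt_ge_zero)
    qed
    \<comment> \<open>Dropping the positive \<open>W d w k\<close> from the denominator leaves
      \<alpha> times the weight.\<close>
    moreover have "japanese k powr r / ?D \<le> japanese k powr t / \<alpha>"
    proof -
      have "japanese k powr r \<le> japanese k powr (2 * s + t)"
        using rts japanese_ge_1 by (intro powr_mono)
      also have "\<dots> = ?J * japanese k powr t"
        by (simp add: powr_add)
      also have "\<dots> \<le> (?D / \<alpha>) * japanese k powr t"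
        using \<alpha> W_pos[of k] by (intro mult_right_mono) (auto simp: field_simps)
      finally show ?thesis
        using D \<alpha> by (simp add: field_simps)
    qed
    ultimately have "(japanese k powr r / ?D) * norm (fourier_coeff (radon_adjoint d w g) k) \<le> (japanese k powr t / \<alpha>) * (C * sqrt (E k))"
      using D \<alpha> by (intro mult_mono) auto
    moreover have "b k = (japanese k powr r / ?D) * norm (fourier_coeff (radon_adjoint d w g) k)"
      unfolding b_def norm_divide norm_of_real using D by simp
    ultimately have "b k \<le> C / \<alpha> * (japanese k powr t * sqrt (E k))"
      by (simp add: mult_ac)
    moreover have "b k \<ge> 0"
      by (simp add: b_def)
    ultimately have "(b k)\<^sup>2 \<le> (C / \<alpha> * (japanese k powr t * sqrt (E k)))\<^sup>2"
      by (rule power_mono)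
    also have "\<dots> = (C / \<alpha>)\<^sup>2 * ((japanese k powr t)\<^sup>2 * (sqrt (E k))\<^sup>2)"
      by (simp only: power_mult_distrib)
    also have "\<dots> = (C / \<alpha>)\<^sup>2 * (japanese k powr (2 * t) * E k)"
      using E[of k] by (simp add: power2_eq_square flip: powr_add)
    finally show ?thesis .
  qed
  note data = data_space_fourier(2,3)[OF g, folded E_def]
  have sum: "(\<lambda>k. (C / \<alpha>)\<^sup>2 * (japanese k powr (2 * t) * E k)) summable_on UNIV"
    by (intro summable_on_cmult_right data(1))
  show sb: "(\<lambda>k. (b k)\<^sup>2) summable_on UNIV"
    using le by (intro summable_on_comparison_test[OF sum]) auto
  have "(\<Sum>\<^sub>\<infinity>k. (b k)\<^sup>2) \<le> (\<Sum>\<^sub>\<infinity>k. (C / \<alpha>)\<^sup>2 * (japanese k powr (2 * t) * E k))"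
    using sb sum le by (intro infsum_mono) auto
  also have "\<dots> = (C / \<alpha>)\<^sup>2 * (\<Sum>\<^sub>\<infinity>k. japanese k powr (2 * t) * E k)"
    by (rule infsum_cmult_right')
  also have "\<dots> \<le> (C / \<alpha>)\<^sup>2 * (data_norm d t w g)\<^sup>2"
    by (intro mult_left_mono data(2)) auto
  also have "\<dots> = (C / \<alpha> * data_norm d t w g)\<^sup>2"
    by (simp add: power_mult_distrib power_divide)
  finally show "sqrt (\<Sum>\<^sub>\<infinity>k. (b k)\<^sup>2) \<le> C / \<alpha> * data_norm d t w g"
    using C \<alpha> data_norm_nonneg[of d t w g] by (intro real_le_lsqrt) auto
qed

section \<open>Sobolev membership and splitting of the total error\<close>

text \<open>Membership accompanies the norm estimates because \<open>sobolev_norm\<close> of a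
  divergent family would be 0 by convention. The part stemming from \<open>f\<close> is dominated by
  \<open>f\<close> itself, as its multiplier lies between 0 and 1.\<close>

lemma tikhonov_sobolev:
  assumes f: "f \<in> sobolev r" and g: "g \<in> data_space d t w" and \<alpha>: "\<alpha> > 0"
    and rts: "r \<le> 2 * s + t" and C: "C > 0"
  shows "tikhonov d w s \<alpha> (radon_adjoint d w (radon f + g)) - f \<in> sobolev r"
proof (rule sobolev_diff[OF _ f])
  let ?u = "tikhonov d w s \<alpha> (radon_adjoint d w (radon f + g))"
  have f': "f \<in> distributions"
    using f by (simp add: sobolev_def)
  have "(\<lambda>k. (japanese k powr r * norm (fourier_coeff ?u k))\<^sup>2) summable_on UNIV"
  proof (rule infsum_l2_triangle(1)[OF _ sobolev_summable[OF f] regularized_noise(1)[OF g \<alpha> rts C]])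
    fix k
    have "norm (of_real (1 - damping d w s \<alpha> k) * fourier_coeff f k) \<le> 1 * norm (fourier_coeff f k)"
      unfolding norm_mult norm_of_real using \<alpha> damping_nonneg[of \<alpha> s k] damping_le_1[of \<alpha> s k]
      by (intro mult_right_mono) auto
    then show "0 \<le> japanese k powr r * norm (fourier_coeff ?u k) \<and>
        japanese k powr r * norm (fourier_coeff ?u k) \<le> japanese k powr r * norm (fourier_coeff f k) +
          japanese k powr r * norm (fourier_coeff (radon_adjoint d w g) k / of_real (W d w k + \<alpha> * japanese k powr (2 * s)))"
      unfolding fourier_coeff_tikhonov[OF f' g less_imp_le[OF \<alpha>]] distrib_left[symmetric]
      by (auto intro!: mult_left_mono norm_triangle_le)
  qed
  then have "trig_series (fourier_coeff ?u) \<in> sobolev r"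
    by (rule trig_series_sobolev)
  \<comment> \<open>A Fourier multiplier is by definition the trigonometric series of its
    coefficients, so \<open>?u\<close> is recovered from them.\<close>
  moreover have "trig_series (fourier_coeff ?u) = ?u"
    unfolding tikhonov_def fourier_coeff_multiplier[abs_def] by (simp only: fourier_multiplier_def)
  ultimately show "?u \<in> sobolev r"
    by simp
qed

text \<open>Subtracting \<open>f\<close> turns the factor \<open>1 - damping\<close> into
  \<open>- damping\<close>; the l2 triangle inequality then separates the regularization error from
  the noise.\<close>

lemma tikhonov_error:
  assumes f: "f \<in> sobolev r" and g: "g \<in> data_space d t w" and \<alpha>: "\<alpha> > 0"
    and rts: "r \<le> 2 * s + t" and C: "C > 0"
  shows "sobolev_norm r (tikhonov d w s \<alpha> (radon_adjoint d w (radon f + g)) - f)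
    \<le> sqrt (\<Sum>\<^sub>\<infinity>k. (japanese k powr r * (damping d w s \<alpha> k * norm (fourier_coeff f k)))\<^sup>2)
      + C / \<alpha> * data_norm d t w g"
proof -
  let ?u = "tikhonov d w s \<alpha> (radon_adjoint d w (radon f + g))"
  let ?a = "\<lambda>k. japanese k powr r * (damping d w s \<alpha> k * norm (fourier_coeff f k))"
  let ?b = "\<lambda>k. japanese k powr r * norm (fourier_coeff (radon_adjoint d w g) k / of_real (W d w k + \<alpha> * japanese k powr (2 * s)))"
  have f': "f \<in> distributions"
    using f by (simp add: sobolev_def)
  have damp: "0 \<le> damping d w s \<alpha> k" "damping d w s \<alpha> k \<le> 1" for k
    using \<alpha> damping_nonneg damping_le_1 by auto
  have a: "(\<lambda>k. (?a k)\<^sup>2) summable_on UNIV"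
    using damp by (intro summable_on_comparison_test[OF sobolev_summable[OF f]] power_mono mult_left_mono)
      (auto simp: mult_left_le_one_le)
  have "sqrt (\<Sum>\<^sub>\<infinity>k. (japanese k powr r * norm (fourier_coeff (?u - f) k))\<^sup>2)
      \<le> sqrt (\<Sum>\<^sub>\<infinity>k. (?a k)\<^sup>2) + sqrt (\<Sum>\<^sub>\<infinity>k. (?b k)\<^sup>2)"
  proof (rule infsum_l2_triangle(2)[OF _ a regularized_noise(1)[OF g \<alpha> rts C]])
    fix k
    have "fourier_coeff (?u - f) k = fourier_coeff (radon_adjoint d w g) k / of_real (W d w k + \<alpha> * japanese k powr (2 * s))
        - of_real (damping d w s \<alpha> k) * fourier_coeff f k"
      unfolding fourier_coeff_diff fourier_coeff_tikhonov[OF f' g less_imp_le[OF \<alpha>]]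
      by (simp add: algebra_simps)
    then have "norm (fourier_coeff (?u - f) k)
        \<le> norm (fourier_coeff (radon_adjoint d w g) k / of_real (W d w k + \<alpha> * japanese k powr (2 * s)))
          + norm (of_real (damping d w s \<alpha> k) * fourier_coeff f k)"
      by (simp only: norm_triangle_ineq4)
    then have "norm (fourier_coeff (?u - f) k) \<le> damping d w s \<alpha> k * norm (fourier_coeff f k)
          + norm (fourier_coeff (radon_adjoint d w g) k / of_real (W d w k + \<alpha> * japanese k powr (2 * s)))"
      unfolding norm_mult[of "of_real _"] norm_of_real using damp[of k] by simp
    then show "0 \<le> japanese k powr r * norm (fourier_coeff (?u - f) k) \<and>
        japanese k powr r * norm (fourier_coeff (?u - f) k) \<le> ?a k + ?b k"
      unfolding distrib_left[symmetric] by (intro conjI mult_left_mono) auto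
  qed
  also have "\<dots> \<le> sqrt (\<Sum>\<^sub>\<infinity>k. (?a k)\<^sup>2) + C / \<alpha> * data_norm d t w g"
    by (intro add_left_mono regularized_noise(2) g \<alpha> rts C)
  finally show ?thesis
    by (simp add: sobolev_norm_eq)
qed

text \<open>At each fixed frequency the damping tends to 0 since \<open>W d w k\<close> is positive,
  and it never exceeds 1, so the Sobolev summand of \<open>f\<close> is a majorant.\<close>

lemma damping_error_tendsto_0:
  assumes f: "f \<in> sobolev r"
  shows "((\<lambda>\<alpha>. \<Sum>\<^sub>\<infinity>k. (japanese k powr r * (damping d w s \<alpha> k * norm (fourier_coeff f k)))\<^sup>2) \<longlongrightarrow> 0) (at_right 0)"
proof (rule tendsto_infsum_dominated[OF sobolev_summable[OF f]])
  show "\<forall>\<^sub>F \<alpha> in at_right 0. \<forall>k\<in>UNIV.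
      0 \<le> (japanese k powr r * (damping d w s \<alpha> k * norm (fourier_coeff f k)))\<^sup>2 \<and>
      (japanese k powr r * (damping d w s \<alpha> k * norm (fourier_coeff f k)))\<^sup>2
        \<le> (japanese k powr r * norm (fourier_coeff f k))\<^sup>2"
    using eventually_at_right_less[of 0]
  proof eventually_elim
    case (elim \<alpha>)
    then show ?case
      using damping_nonneg[of \<alpha> s] damping_le_1[of \<alpha> s]
      by (intro ballI conjI power_mono mult_left_mono) (auto simp: mult_left_le_one_le)
  qed
  fix k
  have "((\<lambda>\<alpha>. damping d w s \<alpha> k) \<longlongrightarrow> 0 * japanese k powr (2 * s) / (W d w k + 0 * japanese k powr (2 * s))) (at_right 0)"
    unfolding damping_def using W_pos[of k] by (intro tendsto_intros) auto
  then have "((\<lambda>\<alpha>. (japanese k powr r * (damping d w s \<alpha> k * norm (fourier_coeff f k)))\<^sup>2)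
      \<longlongrightarrow> (japanese k powr r * (0 * norm (fourier_coeff f k)))\<^sup>2) (at_right 0)"
    by (intro tendsto_intros) simp
  then show "((\<lambda>\<alpha>. (japanese k powr r * (damping d w s \<alpha> k * norm (fourier_coeff f k)))\<^sup>2) \<longlongrightarrow> 0) (at_right 0)"
    by simp
qed

end

section \<open>The rate of the regularization error\<close>

text \<open>Weighted AM-GM for \<open>y / (1 - x)\<close> and \<open>1 / x\<close> with weights \<open>1 - x\<close> and \<open>x\<close>.\<close>

lemma powr_le_rate_const:
  assumes x: "0 < x" "x < 1" and y: "y > 0"
  shows "y powr (1 - x) \<le> rate_const x * (1 + y)"
proof -
  have "(y / (1 - x)) powr (1 - x) * (1 / x) powr x \<le> (1 - x) * (y / (1 - x)) + x * (1 / x)"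
    using x y by (intro Youngs_inequality_0) auto
  then have "y powr (1 - x) / ((1 - x) powr (1 - x) * x powr x) \<le> 1 + y"
    using x y by (simp add: powr_divide mult_ac)
  then have "y powr (1 - x) \<le> (1 - x) powr (1 - x) * x powr x * (1 + y)"
    using x by (simp add: field_simps)
  \<comment> \<open>This is the maximum of \<open>y powr (1 - x) / (1 + y)\<close>, attained at
    \<open>y = (1 - x) / x\<close>.\<close>
  also have "(1 - x) powr (1 - x) * x powr x = rate_const x"
  proof -
    have "1 / x - 1 = (1 - x) / x"
      using x by (simp add: field_simps)
    then have "rate_const x = (x / x powr (1 - x)) * (1 - x) powr (1 - x)"
      using x by (simp add: rate_const_def powr_divide)
    moreover have "x / x powr (1 - x) = x powr x"
      using x by (simp add: field_simps flip: powr_add)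
    ultimately show ?thesis by simp
  qed
  finally show ?thesis .
qed

text \<open>Replacing \<open>W d w k\<close> by its lower bound leaves \<open>y / (1 + y)\<close>,
  where \<open>y\<close> is the regularizing term relative to \<open>c^2\<close>. The exponent
  \<open>x\<close> is chosen so that the \<open>x\<close>-th power of the weight has order
  \<delta>.\<close>

lemma (in bounded_weight) damping_rate:
  assumes \<delta>: "0 < \<delta>" "\<delta> < 2 * s" and \<alpha>: "\<alpha> > 0"
  shows "damping d w s \<alpha> k
    \<le> \<alpha> powr (\<delta> / (2 * s)) * c powr (- \<delta> / s) * rate_const (\<delta> / (2 * s)) * japanese k powr \<delta>"
proof -
  define x where "x = \<delta> / (2 * s)"
  have x: "0 < x" "x < 1" and \<delta>_eq: "2 * s * x = \<delta>" "- \<delta> / s = - (2 * x)"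
    using \<delta> by (auto simp: x_def)
  define y where "y = \<alpha> * japanese k powr (2 * s) / c\<^sup>2"
  have y: "y > 0" and aJ: "\<alpha> * japanese k powr (2 * s) = c\<^sup>2 * y"
    using \<alpha> c_pos by (simp_all add: y_def)
  have "damping d w s \<alpha> k \<le> c\<^sup>2 * y / (c\<^sup>2 + c\<^sup>2 * y)"
    unfolding damping_def aJ using W_lower[of k] W_pos[of k] c_pos y
    by (intro divide_left_mono add_right_mono mult_pos_pos add_pos_pos) auto
  also have "c\<^sup>2 + c\<^sup>2 * y = c\<^sup>2 * (1 + y)"
    by (simp add: distrib_left)
  also have "c\<^sup>2 * y / (c\<^sup>2 * (1 + y)) = y / (1 + y)"
    using c_pos by simp
  \<comment> \<open>The power \<open>y powr x\<close> carries the dependence on \<alpha> and the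
    \<delta> derivatives; the remaining factor is bounded by a constant.\<close>
  also have "\<dots> = y powr x * (y powr (1 - x) / (1 + y))"
    using y by (simp flip: powr_add)
  also have "\<dots> \<le> y powr x * rate_const x"
    using powr_le_rate_const[OF x y] y by (intro mult_left_mono) (auto simp: field_simps)
  also have "y powr x = \<alpha> powr x * (japanese k powr (2 * s)) powr x / (c\<^sup>2) powr x"
    unfolding y_def using \<alpha> c_pos by (simp add: powr_mult powr_divide)
  also have "\<dots> = \<alpha> powr x * c powr (- (2 * x)) * japanese k powr \<delta>"
    using c_pos by (simp add: powr_powr \<delta>_eq powr_minus_divide flip: powr_numeral)
  finally show ?thesis
    unfolding \<delta>_eq(2) x_def[symmetric] by (simp add: mult_ac)
qed

text \<open>The extra weight of order \<delta> in the bound on the damping is absorbed by measuring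
  \<open>f\<close> in the Sobolev space of order \<open>r + \<delta>\<close>.\<close>

lemma (in bounded_weight) damping_error_rate:
  assumes f: "f \<in> sobolev (r + \<delta>)" and \<delta>: "0 < \<delta>" "\<delta> < 2 * s" and \<alpha>: "\<alpha> > 0"
  shows "sqrt (\<Sum>\<^sub>\<infinity>k. (japanese k powr r * (damping d w s \<alpha> k * norm (fourier_coeff f k)))\<^sup>2)
    \<le> \<alpha> powr (\<delta> / (2 * s)) * c powr (- \<delta> / s) * rate_const (\<delta> / (2 * s)) * sobolev_norm (r + \<delta>) f"
proof -
  define K where "K = \<alpha> powr (\<delta> / (2 * s)) * c powr (- \<delta> / s) * rate_const (\<delta> / (2 * s))"
  have K: "K \<ge> 0"
    using \<delta> by (simp add: K_def rate_const_def)
  let ?a = "\<lambda>k. japanese k powr r * (damping d w s \<alpha> k * norm (fourier_coeff f k))"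
  let ?m = "\<lambda>k. (japanese k powr (r + \<delta>) * norm (fourier_coeff f k))\<^sup>2"
  have le: "(?a k)\<^sup>2 \<le> K\<^sup>2 * ?m k" for k
  proof -
    have "?a k \<le> japanese k powr r * ((K * japanese k powr \<delta>) * norm (fourier_coeff f k))"
      using damping_rate[OF \<delta> \<alpha>, of k] unfolding K_def by (intro mult_left_mono mult_right_mono) auto
    then have "?a k \<le> K * (japanese k powr (r + \<delta>) * norm (fourier_coeff f k))"
      by (simp add: powr_add mult_ac)
    then have "(?a k)\<^sup>2 \<le> (K * (japanese k powr (r + \<delta>) * norm (fourier_coeff f k)))\<^sup>2"
      using \<alpha> by (intro power_mono) (auto simp: damping_nonneg)
    then show ?thesis
      by (simp only: power_mult_distrib)
  qed
  have sum: "(\<lambda>k. K\<^sup>2 * ?m k) summable_on UNIV"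
    by (intro summable_on_cmult_right sobolev_summable f)
  have "(\<Sum>\<^sub>\<infinity>k. (?a k)\<^sup>2) \<le> (\<Sum>\<^sub>\<infinity>k. K\<^sup>2 * ?m k)"
    using le by (intro infsum_mono sum summable_on_comparison_test[OF sum]) auto
  also have "\<dots> = K\<^sup>2 * (\<Sum>\<^sub>\<infinity>k. ?m k)"
    by (rule infsum_cmult_right')
  finally have "sqrt (\<Sum>\<^sub>\<infinity>k. (?a k)\<^sup>2) \<le> sqrt (K\<^sup>2 * (\<Sum>\<^sub>\<infinity>k. ?m k))"
    by (rule real_sqrt_le_mono)
  also have "\<dots> = K * sobolev_norm (r + \<delta>) f"
    using K by (simp add: real_sqrt_mult sobolev_norm_eq)
  finally show ?thesis
    by (simp add: K_def)
qed

theorem theorem1p5: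
  fixes w :: "int^'n \<Rightarrow> (rat^'n) set \<Rightarrow> real" and d :: nat
    and c\<^sub>w C\<^sub>w r t s \<delta> :: real
    and f :: "(real^'n \<Rightarrow> complex) \<Rightarrow> complex"
  assumes "CARD('n) \<ge> 2" and "1 \<le> d" and "d \<le> CARD('n) - 1"
    and "weight d w"
    and "c\<^sub>w > 0" and "C\<^sub>w > 0"
    and "\<And>k. c\<^sub>w\<^sup>2 \<le> W d w k" and "\<And>k. W d w k \<le> C\<^sub>w\<^sup>2"
    and "2 * s + t \<ge> r" and "\<delta> \<ge> 0" and "s > 0"
    and "f \<in> sobolev (r + \<delta>)"
  shows
    "(\<forall>\<alpha>>0. \<forall>g\<in>data_space d t w.
        tikhonov d w s \<alpha> (radon_adjoint d w (radon f + g)) - f \<in> sobolev r) \<and>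
     ((\<lambda>\<epsilon>. SUP g \<in> {g \<in> data_space d t w. data_norm d t w g \<le> \<epsilon>}.
        ereal (sobolev_norm r (tikhonov d w s (sqrt \<epsilon>) (radon_adjoint d w (radon f + g)) - f)))
        \<longlongrightarrow> 0) (at_right 0) \<and>
     (\<forall>\<epsilon> \<alpha>. \<forall>g\<in>data_space d t w.
        data_norm d t w g \<le> \<epsilon> \<longrightarrow> 0 < \<delta> \<longrightarrow> \<delta> < 2 * s \<longrightarrow>
        0 < \<alpha> \<longrightarrow> \<alpha> \<le> c\<^sub>w\<^sup>2 * (2 * s / \<delta> - 1) \<longrightarrow>
        sobolev_norm r (tikhonov d w s \<alpha> (radon_adjoint d w (radon f + g)) - f)
          \<le> \<alpha> powr (\<delta> / (2 * s)) * c\<^sub>w powr (- \<delta> / s) * rate_const (\<delta> / (2 * s))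
              * sobolev_norm (r + \<delta>) f
            + C\<^sub>w ^ 3 * c\<^sub>w powi (-2) * (\<epsilon> / \<alpha>))"
proof (intro conjI allI ballI impI)
  interpret bounded_weight d w c\<^sub>w C\<^sub>w
    using assms by unfold_locales
  have f: "f \<in> sobolev r"
    using assms by (auto intro: sobolev_antimono)
  note hyps = \<open>2 * s + t \<ge> r\<close> \<open>C\<^sub>w > 0\<close>
  let ?err = "\<lambda>\<alpha> g. sobolev_norm r (tikhonov d w s \<alpha> (radon_adjoint d w (radon f + g)) - f)"
  let ?q = "\<lambda>\<alpha>. \<Sum>\<^sub>\<infinity>k. (japanese k powr r * (damping d w s \<alpha> k * norm (fourier_coeff f k)))\<^sup>2"
  show "tikhonov d w s \<alpha> (radon_adjoint d w (radon f + g)) - f \<in> sobolev r"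
    if "\<alpha> > 0" "g \<in> data_space d t w" for \<alpha> g
    using that by (intro tikhonov_sobolev[OF f _ _ hyps])
  show "((\<lambda>\<epsilon>. SUP g \<in> {g \<in> data_space d t w. data_norm d t w g \<le> \<epsilon>}. ereal (?err (sqrt \<epsilon>) g))
      \<longlongrightarrow> 0) (at_right 0)"
  \<comment> \<open>In \<open>ereal\<close> the supremum exists before it is known to be bounded.
    Zero data give the lower bound 0, the error splitting gives the upper one.\<close>
  proof (rule tendsto_sandwich)
    show "\<forall>\<^sub>F \<epsilon> in at_right 0. 0 \<le> (SUP g \<in> {g \<in> data_space d t w. data_norm d t w g \<le> \<epsilon>}. ereal (?err (sqrt \<epsilon>) g))"
      using eventually_at_right_less[of 0]
    proof eventually_elim
      case (elim \<epsilon>)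
      then show ?case
        by (intro SUP_upper2[of "\<lambda>A \<phi>. 0"])
          (auto simp: zero_in_data_space data_norm_zero sobolev_norm_def infsum_nonneg)
    qed
    show "\<forall>\<^sub>F \<epsilon> in at_right 0. (SUP g \<in> {g \<in> data_space d t w. data_norm d t w g \<le> \<epsilon>}. ereal (?err (sqrt \<epsilon>) g))
        \<le> ereal (sqrt (?q (sqrt \<epsilon>)) + C\<^sub>w * sqrt \<epsilon>)"
      using eventually_at_right_less[of 0]
    proof eventually_elim
      case (elim \<epsilon>)
      show ?case
      proof (rule SUP_least)
        fix g assume g: "g \<in> {g \<in> data_space d t w. data_norm d t w g \<le> \<epsilon>}"
        have "?err (sqrt \<epsilon>) g \<le> sqrt (?q (sqrt \<epsilon>)) + C\<^sub>w / sqrt \<epsilon> * data_norm d t w g"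
          using g elim by (intro tikhonov_error f hyps) auto
        also have "\<dots> \<le> sqrt (?q (sqrt \<epsilon>)) + C\<^sub>w / sqrt \<epsilon> * \<epsilon>"
          using g elim hyps by (intro add_left_mono mult_left_mono) auto
        \<comment> \<open>With \<alpha> equal to \<open>sqrt \<epsilon>\<close> the noise bound is
          of order \<epsilon> / \<alpha>, hence still vanishes while \<alpha> tends to 0.\<close>
        also have "C\<^sub>w / sqrt \<epsilon> * \<epsilon> = C\<^sub>w * sqrt \<epsilon>"
          using elim real_div_sqrt[of \<epsilon>] by (metis less_imp_le times_divide_eq_left times_divide_eq_right)
        finally show "ereal (?err (sqrt \<epsilon>) g) \<le> ereal (sqrt (?q (sqrt \<epsilon>)) + C\<^sub>w * sqrt \<epsilon>)"
          by (simp only: ereal_less_eq)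
      qed
    qed
    have sqrt_lim: "((\<lambda>\<epsilon>. sqrt \<epsilon>) \<longlongrightarrow> sqrt 0) (at_right 0)"
      by (intro tendsto_intros)
    \<comment> \<open>The argument must stay positive, since the damping error is known to converge
      only from the right.\<close>
    moreover have "\<forall>\<^sub>F \<epsilon> in at_right 0. sqrt \<epsilon> \<in> {0<..} \<and> sqrt \<epsilon> \<noteq> 0"
      using eventually_at_right_less[of 0] by eventually_elim auto
    ultimately have "filterlim (\<lambda>\<epsilon>::real. sqrt \<epsilon>) (at_right 0) (at_right 0)"
      by (simp add: filterlim_at)
    then have "((\<lambda>\<epsilon>. sqrt (?q (sqrt \<epsilon>)) + C\<^sub>w * sqrt \<epsilon>) \<longlongrightarrow> sqrt 0 + C\<^sub>w * sqrt 0) (at_right 0)"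
      by (intro tendsto_intros filterlim_compose[OF damping_error_tendsto_0[OF f]]) auto
    then show "((\<lambda>\<epsilon>. ereal (sqrt (?q (sqrt \<epsilon>)) + C\<^sub>w * sqrt \<epsilon>)) \<longlongrightarrow> 0) (at_right 0)"
      by (simp add: zero_ereal_def)
  qed simp
  fix \<epsilon> \<alpha> :: real and g
  assume g: "g \<in> data_space d t w" "data_norm d t w g \<le> \<epsilon>" and \<delta>: "0 < \<delta>" "\<delta> < 2 * s" and \<alpha>: "0 < \<alpha>"
  have "?err \<alpha> g \<le> sqrt (?q \<alpha>) + C\<^sub>w / \<alpha> * data_norm d t w g"
    using g \<alpha> by (intro tikhonov_error f hyps)
  also have "\<dots> \<le> \<alpha> powr (\<delta> / (2 * s)) * c\<^sub>w powr (- \<delta> / s) * rate_const (\<delta> / (2 * s)) * sobolev_norm (r + \<delta>) f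
      + C\<^sub>w ^ 3 * c\<^sub>w powi (-2) * (\<epsilon> / \<alpha>)"
  proof (rule add_mono)
    have \<epsilon>: "\<epsilon> \<ge> 0"
      using g(2) data_norm_nonneg[of d t w g] by linarith
    \<comment> \<open>Since \<open>W d w 0\<close> lies between both squares, multiplying the
      constant \<open>C\<^sub>w\<close> of the noise bound by this quotient brings it into the
      stated form.\<close>
    have "1 \<le> C\<^sub>w\<^sup>2 / c\<^sub>w\<^sup>2"
      using W_lower[of 0] W_upper[of 0] c_pos by (simp add: field_simps)
    then have "C\<^sub>w * 1 \<le> C\<^sub>w * (C\<^sub>w\<^sup>2 / c\<^sub>w\<^sup>2)"
      using hyps by (intro mult_left_mono) auto
    also have "\<dots> = C\<^sub>w ^ 3 * c\<^sub>w powi (-2)"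
      by (simp add: power_int_minus power2_eq_square power3_eq_cube divide_inverse)
    finally have "C\<^sub>w * (\<epsilon> / \<alpha>) \<le> C\<^sub>w ^ 3 * c\<^sub>w powi (-2) * (\<epsilon> / \<alpha>)"
      using \<epsilon> \<alpha> by (intro mult_right_mono) auto
    moreover have "C\<^sub>w / \<alpha> * data_norm d t w g \<le> C\<^sub>w / \<alpha> * \<epsilon>"
      using g(2) hyps \<alpha> by (intro mult_left_mono) auto
    ultimately show "C\<^sub>w / \<alpha> * data_norm d t w g \<le> C\<^sub>w ^ 3 * c\<^sub>w powi (-2) * (\<epsilon> / \<alpha>)"
      by simp
  qed (rule damping_error_rate[OF assms(12) \<delta> \<alpha>])
  finally show "?err \<alpha> g \<le> \<alpha> powr (\<delta> / (2 * s)) * c\<^sub>w powr (- \<delta> / s) * rate_const (\<delta> / (2 * s)) * sobolev_norm (r + \<delta>) f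
      + C\<^sub>w ^ 3 * c\<^sub>w powi (-2) * (\<epsilon> / \<alpha>)" .
qed

end
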